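(* Let $A$ be a Banach algebra and let $\phi\in\Delta(A)$. If $A^{**}$ is left $\tilde{\phi}$-biprojective, then $A$ is left $\phi$-biflat.
   Context: For a Banach algebra $A$, $\Delta(A)$ is the set of all non-zero multiplicative linear functionals on $A$. The bidual $A^{**}$ is a Banach algebra under the (first) Arens product, and $\phi\in\Delta(A)$ extends to $\tilde{\phi}\in\Delta(A^{**})$ by $\tilde{\phi}(F)=F(\phi)$ for $F\in A^{**}$. For a Banach algebra $A$, $A\otimes_{p}A$ is the projective tensor product, a Banach $A$-bimodule via $a\cdot(b\otimes c)=ab\otimes c$, $(b\otimes c)\cdot a=b\otimes ca$; $\pi_A:A\otimes_p A\to A$ is the bounded linear map with $\pi_A(a\otimes b)=ab$. For a Banach $A$-bimodule $X$, $X^*$ is a Banach $A$-bimodule via $(a\cdot f)(x)=f(x\cdot a)$, $(f\cdot a)(x)=f(a\cdot x)$; iterating, $(A\otimes_pA)^{**}$ is a Banach $A$-bimodule. $A$ is left $\phi$-biprojective if there is a bounded linear map $\rho:A\to A\otimes_pA$ with $\rho(ab)=a\cdot\rho(b)=\phi(b)\rho(a)$ and $\phi\circ\pi_A\circ\rho(a)=\phi(a)$ for all $a,b\in A$. (For $A^{**}$ and $\tilde\phi$ this definition is applied to the Banach algebra $A^{**}$ in place of $A$.) $A$ is left $\phi$-biflat if there is a bounded linear map $\rho:A\to(A\otimes_pA)^{**}$ with $\rho(ab)=\phi(b)\rho(a)=a\cdot\rho(b)$ and $\tilde{\phi}\circ\pi_A^{**}\circ\rho(a)=\phi(a)$ for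 all $a,b\in A$. *)

theory Defs
  imports "HOL-Analysis.Analysis"
begin

section \<open>Complex normed spaces and complex Banach algebras\<close>

text \<open>
  The library only has real normed spaces.  A complex normed space is a real one
  together with a compatible complex scalar multiplication, so that all topological
  notions of the library apply unchanged.
\<close>

class complex_normed_vector = real_normed_vector +
  fixes scaleC :: "complex \<Rightarrow> 'a \<Rightarrow> 'a" (infixr "*\<^sub>C" 75)
  assumes scaleC_add_right: "c *\<^sub>C (x + y) = c *\<^sub>C x + c *\<^sub>C y"
    and scaleC_add_left: "(c + d) *\<^sub>C x = c *\<^sub>C x + d *\<^sub>C x"
    and scaleC_scaleC: "c *\<^sub>C d *\<^sub>C x = (c * d) *\<^sub>C x"
    and scaleC_of_real: "complex_of_real r *\<^sub>C x = r *\<^sub>R x"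
    and norm_scaleC: "norm (c *\<^sub>C x) = cmod c * norm x"

class complex_banach = complex_normed_vector + banach

text \<open>No unit is required.\<close>

class complex_banach_algebra = complex_banach + real_normed_algebra +
  assumes scaleC_mult_left: "(c *\<^sub>C x) * y = c *\<^sub>C (x * y)"
    and scaleC_mult_right: "x * (c *\<^sub>C y) = c *\<^sub>C (x * y)"

instantiation complex :: complex_banach_algebra
begin
definition scaleC_complex :: "complex \<Rightarrow> complex \<Rightarrow> complex"
  where "scaleC_complex c x = c * x"
instance
  by standard (auto simp: scaleC_complex_def algebra_simps norm_mult scaleR_conv_of_real)
end

declare scaleC_complex_def [simp]

lemma scaleC_one [simp]: "1 *\<^sub>C (x::'a::complex_normed_vector) = x"
  using scaleC_of_real[of 1 x] by simp

lemma scaleC_zero_right [simp]: "c *\<^sub>C (0::'a::complex_normed_vector) = 0"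
  using scaleC_add_right[of c 0 "0::'a"] by simp

lemma scaleC_minus_right: "c *\<^sub>C (- x) = - (c *\<^sub>C (x::'a::complex_normed_vector))"
  using scaleC_add_right[of c x "- x"] by (simp add: eq_neg_iff_add_eq_0 add.commute)

lemma scaleC_diff_right: "c *\<^sub>C (x - y) = c *\<^sub>C x - c *\<^sub>C (y::'a::complex_normed_vector)"
  using scaleC_add_right[of c x "- y"] by (simp add: scaleC_minus_right)

lemma scaleC_scaleR_commute: "c *\<^sub>C r *\<^sub>R x = r *\<^sub>R c *\<^sub>C (x::'a::complex_normed_vector)"
  by (simp add: scaleC_of_real[symmetric] scaleC_scaleC mult.commute)

lemma bounded_linear_scaleC: "bounded_linear (\<lambda>x::'a::complex_normed_vector. c *\<^sub>C x)"
  by (rule bounded_linear_intro[where K = "cmod c"])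
     (auto simp: scaleC_add_right scaleC_scaleR_commute norm_scaleC)

lemma continuous_scaleC: "isCont (\<lambda>x::'a::complex_normed_vector. c *\<^sub>C x) x"
  by (rule bounded_linear.isCont[OF bounded_linear_scaleC continuous_ident])

section \<open>Bounded complex-linear operators and dual spaces\<close>

definition bounded_clinear :: "('a::complex_normed_vector \<Rightarrow> 'b::complex_normed_vector) \<Rightarrow> bool"
  where "bounded_clinear f \<longleftrightarrow> bounded_linear f \<and> (\<forall>c x. f (c *\<^sub>C x) = c *\<^sub>C f x)"

lemma bounded_clinear_intro:
  assumes "\<And>x y. f (x + y) = f x + f y" "\<And>c x. f (c *\<^sub>C x) = c *\<^sub>C f x"
    and "\<And>x. norm (f x) \<le> norm x * K"
  shows "bounded_clinear f"
proof -
  have "bounded_linear f"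
  proof (rule bounded_linear_intro[where K = K])
    show "f (r *\<^sub>R x) = r *\<^sub>R f x" for r x
      using assms(2)[of "complex_of_real r" x] by (simp add: scaleC_of_real)
  qed (use assms in auto)
  then show ?thesis using assms(2) by (simp add: bounded_clinear_def)
qed

text \<open>A closed complex-linear subspace of the library's space of bounded real-linear
  operators; it inherits the operator norm.\<close>

typedef (overloaded) ('a, 'b) cblinfun  ("(_ \<Rightarrow>\<^sub>C\<^sub>L /_)" [22, 21] 21) =
  "{f :: 'a::complex_normed_vector \<Rightarrow>\<^sub>L 'b::complex_normed_vector. bounded_clinear (blinfun_apply f)}"
  by (rule exI[where x = 0]) (simp add: bounded_clinear_def blinfun.bounded_linear_right)

type_synonym 'a dual = "'a \<Rightarrow>\<^sub>C\<^sub>L complex"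

definition cblinfun_apply ::
    "('a::complex_normed_vector \<Rightarrow>\<^sub>C\<^sub>L 'b::complex_normed_vector) \<Rightarrow> 'a \<Rightarrow> 'b"
  where "cblinfun_apply f = blinfun_apply (Rep_cblinfun f)"

declare [[coercion
  "cblinfun_apply :: ('a::complex_normed_vector \<Rightarrow>\<^sub>C\<^sub>L 'b::complex_normed_vector) \<Rightarrow> 'a \<Rightarrow> 'b"]]

text \<open>Only meaningful for bounded complex-linear arguments.\<close>

definition CBlinfun :: "('a::complex_normed_vector \<Rightarrow> 'b::complex_normed_vector) \<Rightarrow> 'a \<Rightarrow>\<^sub>C\<^sub>L 'b"
  where "CBlinfun f = Abs_cblinfun (Blinfun f)"

lemma CBlinfun_inverse: "bounded_clinear f \<Longrightarrow> cblinfun_apply (CBlinfun f) = f"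
  by (simp add: cblinfun_apply_def CBlinfun_def Abs_cblinfun_inverse bounded_clinear_def
      bounded_linear_Blinfun_apply)

lemma bounded_clinear_cblinfun_apply: "bounded_clinear (cblinfun_apply f)"
  using Rep_cblinfun[of f] by (simp add: cblinfun_apply_def)

lemma cblinfun_eqI: "(\<And>x. cblinfun_apply f x = cblinfun_apply g x) \<Longrightarrow> f = g"
  by (metis Rep_cblinfun_inject blinfun_eqI cblinfun_apply_def)

lemma cblinfun_scaleC_right: "cblinfun_apply f (c *\<^sub>C x) = c *\<^sub>C cblinfun_apply f x"
  using bounded_clinear_cblinfun_apply[of f] by (simp add: bounded_clinear_def)

instantiation cblinfun :: (complex_normed_vector, complex_normed_vector) complex_normed_vector
begin

definition norm_cblinfun :: "'a \<Rightarrow>\<^sub>C\<^sub>L 'b \<Rightarrow> real"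
  where "norm_cblinfun f = norm (Rep_cblinfun f)"
definition zero_cblinfun :: "'a \<Rightarrow>\<^sub>C\<^sub>L 'b"
  where "zero_cblinfun = CBlinfun (\<lambda>x. 0)"
definition plus_cblinfun :: "'a \<Rightarrow>\<^sub>C\<^sub>L 'b \<Rightarrow> 'a \<Rightarrow>\<^sub>C\<^sub>L 'b \<Rightarrow> 'a \<Rightarrow>\<^sub>C\<^sub>L 'b"
  where "plus_cblinfun f g = CBlinfun (\<lambda>x. cblinfun_apply f x + cblinfun_apply g x)"
definition minus_cblinfun :: "'a \<Rightarrow>\<^sub>C\<^sub>L 'b \<Rightarrow> 'a \<Rightarrow>\<^sub>C\<^sub>L 'b \<Rightarrow> 'a \<Rightarrow>\<^sub>C\<^sub>L 'b"
  where "minus_cblinfun f g = CBlinfun (\<lambda>x. cblinfun_apply f x - cblinfun_apply g x)"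
definition uminus_cblinfun :: "'a \<Rightarrow>\<^sub>C\<^sub>L 'b \<Rightarrow> 'a \<Rightarrow>\<^sub>C\<^sub>L 'b"
  where "uminus_cblinfun f = CBlinfun (\<lambda>x. - cblinfun_apply f x)"
definition scaleR_cblinfun :: "real \<Rightarrow> 'a \<Rightarrow>\<^sub>C\<^sub>L 'b \<Rightarrow> 'a \<Rightarrow>\<^sub>C\<^sub>L 'b"
  where "scaleR_cblinfun r f = CBlinfun (\<lambda>x. r *\<^sub>R cblinfun_apply f x)"
definition scaleC_cblinfun :: "complex \<Rightarrow> 'a \<Rightarrow>\<^sub>C\<^sub>L 'b \<Rightarrow> 'a \<Rightarrow>\<^sub>C\<^sub>L 'b"
  where "scaleC_cblinfun c f = CBlinfun (\<lambda>x. c *\<^sub>C cblinfun_apply f x)"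
definition sgn_cblinfun :: "'a \<Rightarrow>\<^sub>C\<^sub>L 'b \<Rightarrow> 'a \<Rightarrow>\<^sub>C\<^sub>L 'b"
  where "sgn_cblinfun f = inverse (norm f) *\<^sub>R f"
definition dist_cblinfun :: "'a \<Rightarrow>\<^sub>C\<^sub>L 'b \<Rightarrow> 'a \<Rightarrow>\<^sub>C\<^sub>L 'b \<Rightarrow> real"
  where "dist_cblinfun f g = norm (f - g)"
definition uniformity_cblinfun :: "(('a \<Rightarrow>\<^sub>C\<^sub>L 'b) \<times> ('a \<Rightarrow>\<^sub>C\<^sub>L 'b)) filter"
  where "uniformity_cblinfun = (INF e\<in>{0<..}. principal {(x, y). dist x y < e})"
definition open_cblinfun :: "('a \<Rightarrow>\<^sub>C\<^sub>L 'b) set \<Rightarrow> bool"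
  where "open_cblinfun S = (\<forall>x\<in>S. \<forall>\<^sub>F (x', y) in uniformity. x' = x \<longrightarrow> y \<in> S)"

lemma bounded_linear_cblinfun: "bounded_linear (cblinfun_apply (f :: 'a \<Rightarrow>\<^sub>C\<^sub>L 'b))"
  using bounded_clinear_cblinfun_apply[of f] by (simp add: bounded_clinear_def)

lemma cblinfun_ops_apply:
  fixes f g :: "'a \<Rightarrow>\<^sub>C\<^sub>L 'b"
  shows "cblinfun_apply (0 :: 'a \<Rightarrow>\<^sub>C\<^sub>L 'b) x = 0"
    and "cblinfun_apply (f + g) x = cblinfun_apply f x + cblinfun_apply g x"
    and "cblinfun_apply (f - g) x = cblinfun_apply f x - cblinfun_apply g x"
    and "cblinfun_apply (- f) x = - cblinfun_apply f x"
    and "cblinfun_apply (r *\<^sub>R f) x = r *\<^sub>R cblinfun_apply f x"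
    and "cblinfun_apply (c *\<^sub>C f) x = c *\<^sub>C cblinfun_apply f x"
proof -
  note bl = bounded_linear_cblinfun
  note rules = bounded_clinear_def scaleC_add_right scaleC_diff_right scaleC_minus_right
    cblinfun_scaleC_right scaleC_scaleR_commute scaleC_scaleC mult.commute
  have 1: "bounded_clinear (\<lambda>x::'a. 0::'b)" by (simp add: bounded_clinear_def)
  show "cblinfun_apply (0 :: 'a \<Rightarrow>\<^sub>C\<^sub>L 'b) x = 0"
    by (simp add: zero_cblinfun_def CBlinfun_inverse 1)
  have 2: "bounded_clinear (\<lambda>x. cblinfun_apply f x + cblinfun_apply g x)"
    by (simp add: rules bounded_linear_add bl)
  show "cblinfun_apply (f + g) x = cblinfun_apply f x + cblinfun_apply g x"
    by (simp add: plus_cblinfun_def CBlinfun_inverse 2)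
  have 3: "bounded_clinear (\<lambda>x. cblinfun_apply f x - cblinfun_apply g x)"
    by (simp add: rules bounded_linear_sub bl)
  show "cblinfun_apply (f - g) x = cblinfun_apply f x - cblinfun_apply g x"
    by (simp add: minus_cblinfun_def CBlinfun_inverse 3)
  have 4: "bounded_clinear (\<lambda>x. - cblinfun_apply f x)"
    by (simp add: rules bounded_linear_minus bl)
  show "cblinfun_apply (- f) x = - cblinfun_apply f x"
    by (simp add: uminus_cblinfun_def CBlinfun_inverse 4)
  have 5: "bounded_clinear (\<lambda>x. r *\<^sub>R cblinfun_apply f x)"
    by (simp add: rules bounded_linear_const_scaleR bl)
  show "cblinfun_apply (r *\<^sub>R f) x = r *\<^sub>R cblinfun_apply f x"
    by (simp add: scaleR_cblinfun_def CBlinfun_inverse 5)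
  have 6: "bounded_clinear (\<lambda>x. c *\<^sub>C cblinfun_apply f x)"
    by (simp add: rules bounded_linear_compose[OF bounded_linear_scaleC] bl)
  show "cblinfun_apply (c *\<^sub>C f) x = c *\<^sub>C cblinfun_apply f x"
    by (simp add: scaleC_cblinfun_def CBlinfun_inverse 6)
qed

lemma Rep_cblinfun_ops:
  fixes f g :: "'a \<Rightarrow>\<^sub>C\<^sub>L 'b"
  shows "Rep_cblinfun (0 :: 'a \<Rightarrow>\<^sub>C\<^sub>L 'b) = 0"
    and "Rep_cblinfun (f + g) = Rep_cblinfun f + Rep_cblinfun g"
    and "Rep_cblinfun (f - g) = Rep_cblinfun f - Rep_cblinfun g"
    and "Rep_cblinfun (- f) = - Rep_cblinfun f"
    and "Rep_cblinfun (r *\<^sub>R f) = r *\<^sub>R Rep_cblinfun f"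
  by (auto intro!: blinfun_eqI
      simp: cblinfun_ops_apply[unfolded cblinfun_apply_def] blinfun.bilinear_simps)

lemma norm_cblinfun_eq_onorm: "norm (f :: 'a \<Rightarrow>\<^sub>C\<^sub>L 'b) = onorm (cblinfun_apply f)"
  by (simp add: norm_cblinfun_def norm_blinfun.rep_eq cblinfun_apply_def)

instance
proof
  fix f g h :: "'a \<Rightarrow>\<^sub>C\<^sub>L 'b" and r s :: real and c d :: complex
  show "f + g + h = f + (g + h)" "f + g = g + f" "0 + f = f" "- f + f = 0" "f - g = f + - g"
    "r *\<^sub>R (f + g) = r *\<^sub>R f + r *\<^sub>R g" "(r + s) *\<^sub>R f = r *\<^sub>R f + s *\<^sub>R f"
    "r *\<^sub>R s *\<^sub>R f = (r * s) *\<^sub>R f" "1 *\<^sub>R f = f"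
    "c *\<^sub>C (f + g) = c *\<^sub>C f + c *\<^sub>C g" "(c + d) *\<^sub>C f = c *\<^sub>C f + d *\<^sub>C f"
    "c *\<^sub>C d *\<^sub>C f = (c * d) *\<^sub>C f" "complex_of_real r *\<^sub>C f = r *\<^sub>R f"
    by (rule cblinfun_eqI, simp add: cblinfun_ops_apply scaleR_add_left scaleR_add_right
        scaleC_add_right scaleC_add_left scaleC_scaleC scaleC_of_real ac_simps)+
  show "(norm f = 0) = (f = 0)"
    by (simp add: norm_cblinfun_def Rep_cblinfun_inject[symmetric] Rep_cblinfun_ops)
  show "norm (f + g) \<le> norm f + norm g"
    by (simp add: norm_cblinfun_def Rep_cblinfun_ops norm_triangle_ineq)
  show "norm (r *\<^sub>R f) = \<bar>r\<bar> * norm f"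
    by (simp add: norm_cblinfun_def Rep_cblinfun_ops)
  show "norm (c *\<^sub>C f) = cmod c * norm f"
  proof (rule antisym)
    have le: "norm (c *\<^sub>C f) \<le> cmod c * norm f" for c and f :: "'a \<Rightarrow>\<^sub>C\<^sub>L 'b"
      unfolding norm_cblinfun_eq_onorm
    proof (rule onorm_bound)
      show "0 \<le> cmod c * onorm (cblinfun_apply f)"
        by (simp add: onorm_pos_le bounded_linear_cblinfun)
      show "norm (cblinfun_apply (c *\<^sub>C f) x) \<le> cmod c * onorm (cblinfun_apply f) * norm x" for x
        using onorm[OF bounded_linear_cblinfun[of f], of x]
        by (simp add: cblinfun_ops_apply norm_scaleC mult.assoc mult_left_mono)
    qed
    show "norm (c *\<^sub>C f) \<le> cmod c * norm f" by (rule le)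
    show "cmod c * norm f \<le> norm (c *\<^sub>C f)"
    proof (cases "c = 0")
      case True
      then show ?thesis by (simp add: norm_cblinfun_def)
    next
      case False
      have "inverse c *\<^sub>C c *\<^sub>C f = f"
        using False by (intro cblinfun_eqI) (simp add: cblinfun_ops_apply scaleC_scaleC)
      then have "norm f \<le> cmod (inverse c) * norm (c *\<^sub>C f)"
        using le[of "inverse c" "c *\<^sub>C f"] by simp
      then have "cmod c * norm f \<le> cmod c * (cmod (inverse c) * norm (c *\<^sub>C f))"
        by (rule mult_left_mono) simp
      also have "\<dots> = cmod (c * inverse c) * norm (c *\<^sub>C f)"
        by (simp only: norm_mult mult.assoc)
      finally show ?thesis
        using False by simp
    qed
  qed
qed (rule sgn_cblinfun_def dist_cblinfun_def uniformity_cblinfun_def open_cblinfun_def)+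

end

lemma norm_cblinfun_le: "norm (cblinfun_apply f x) \<le> norm f * norm x"
  unfolding norm_cblinfun_eq_onorm by (rule onorm[OF bounded_linear_cblinfun])

lemma norm_cblinfun_bound:
  "0 \<le> b \<Longrightarrow> (\<And>x. norm (cblinfun_apply f x) \<le> b * norm x) \<Longrightarrow> norm f \<le> b"
  unfolding norm_cblinfun_eq_onorm by (rule onorm_bound)

lemmas cblinfun_right_simps =
  linear_simps[OF bounded_linear_cblinfun] cblinfun_scaleC_right

lemma complete_via_Rep:
  fixes Rep :: "'a::real_normed_vector \<Rightarrow> 'b::banach" and X :: "nat \<Rightarrow> 'a"
  assumes norm: "\<And>x. norm (Rep x) = norm x" and diff: "\<And>x y. Rep (x - y) = Rep x - Rep y"
    and closed: "closed (range Rep)" and X: "Cauchy X"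
  shows "convergent X"
proof -
  have d: "dist (Rep x) (Rep y) = dist x y" for x y
    by (simp add: dist_norm diff[symmetric] norm)
  have "Cauchy (\<lambda>n. Rep (X n))"
    using X by (simp add: Cauchy_def d)
  then obtain l where l: "(\<lambda>n. Rep (X n)) \<longlonglongrightarrow> l"
    using Cauchy_convergent[THEN convergentD] by auto
  then have "l \<in> range Rep"
    by (rule closed_sequentially[OF closed, rotated]) simp
  then obtain x where "l = Rep x" by blast
  with l have "X \<longlonglongrightarrow> x"
    by (simp add: lim_sequentially d)
  then show ?thesis by (auto simp: convergent_def)
qed

lemma range_Rep_cblinfun:
  "range (Rep_cblinfun :: ('a::complex_normed_vector \<Rightarrow>\<^sub>C\<^sub>L 'b::complex_normed_vector) \<Rightarrow> _)
    = {f. bounded_clinear (blinfun_apply f)}"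
  using type_definition.Rep_range[OF type_definition_cblinfun] .

instance cblinfun :: (complex_normed_vector, complex_banach) complex_banach
proof
  fix X :: "nat \<Rightarrow> 'a \<Rightarrow>\<^sub>C\<^sub>L 'b"
  assume "Cauchy X"
  moreover have "closed (range (Rep_cblinfun :: ('a \<Rightarrow>\<^sub>C\<^sub>L 'b) \<Rightarrow> _))"
  proof -
    have "{f :: 'a \<Rightarrow>\<^sub>L 'b. bounded_clinear (blinfun_apply f)}
        = (\<Inter>c. \<Inter>x. {f. blinfun_apply f (c *\<^sub>C x) = c *\<^sub>C blinfun_apply f x})"
      by (auto simp: bounded_clinear_def blinfun.bounded_linear_right)
    moreover have "closed {f :: 'a \<Rightarrow>\<^sub>L 'b. blinfun_apply f (c *\<^sub>C x) = c *\<^sub>C blinfun_apply f x}" for c x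
    proof (rule closed_Collect_eq)
      show "continuous_on UNIV (\<lambda>f :: 'a \<Rightarrow>\<^sub>L 'b. blinfun_apply f (c *\<^sub>C x))"
        by (intro linear_continuous_on bounded_linear_apply_blinfun)
      show "continuous_on UNIV (\<lambda>f :: 'a \<Rightarrow>\<^sub>L 'b. c *\<^sub>C blinfun_apply f x)"
        by (intro linear_continuous_on bounded_linear_compose[OF bounded_linear_scaleC]
            bounded_linear_apply_blinfun)
    qed
    ultimately show ?thesis
      unfolding range_Rep_cblinfun by (simp add: closed_INT)
  qed
  ultimately show "convergent X"
    by (intro complete_via_Rep[where Rep = Rep_cblinfun])
       (auto simp: norm_cblinfun_def Rep_cblinfun_ops)
qed

section \<open>Hahn--Banach\<close>

definition sublinear :: "('a::real_vector \<Rightarrow> real) \<Rightarrow> bool"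
  where "sublinear p \<longleftrightarrow> (\<forall>x y. p (x + y) \<le> p x + p y) \<and> (\<forall>r x. r \<ge> 0 \<longrightarrow> p (r *\<^sub>R x) = r * p x)"

lemma sublinearD:
  assumes "sublinear p"
  shows "p (x + y) \<le> p x + p y" "r \<ge> 0 \<Longrightarrow> p (r *\<^sub>R x) = r * p x" "p 0 = 0" "- p (- x) \<le> p x"
proof -
  show 1: "p (x + y) \<le> p x + p y" for x y using assms by (simp add: sublinear_def)
  show 2: "r \<ge> 0 \<Longrightarrow> p (r *\<^sub>R x) = r * p x" for r x using assms by (simp add: sublinear_def)
  show 3: "p 0 = 0" using 2[of 0 0] by simp
  show "- p (- x) \<le> p x" using 1[of x "- x"] 3 by simp
qed

lemma sublinearI:
  assumes add: "\<And>x y. p (x + y) \<le> p x + p y" and zero: "p 0 = 0"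
    and le: "\<And>r x. r > 0 \<Longrightarrow> p (r *\<^sub>R x) \<le> r * p x"
  shows "sublinear p"
proof -
  have "p (r *\<^sub>R x) = r * p x" if "r \<ge> 0" for r x
  proof (cases "r = 0")
    case False
    with that have r: "r > 0" by simp
    have "p (inverse r *\<^sub>R r *\<^sub>R x) \<le> inverse r * p (r *\<^sub>R x)"
      using r by (intro le) simp
    then have "r * p x \<le> p (r *\<^sub>R x)" using r by (simp add: field_simps)
    with le[OF r, of x] show ?thesis by simp
  qed (simp add: zero)
  with add show ?thesis by (simp add: sublinear_def)
qed

lemma sublinear_shrink:
  fixes p :: "'a::real_vector \<Rightarrow> real"
  assumes p: "sublinear p"
  obtains q where "sublinear q" "\<And>x. q x \<le> p x" "q (- y) \<le> - p y"
proof
  define q where "q x = (INF t\<in>{0..}. p (x + t *\<^sub>R y) - t * p y)" for x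
  have low: "- p (- x) \<le> p (x + t *\<^sub>R y) - t * p y" if "t \<ge> 0" for x t
    using sublinearD(1)[OF p, of "x + t *\<^sub>R y" "- x"] sublinearD(2)[OF p that, of y] by simp
  have bdd: "bdd_below ((\<lambda>t. p (x + t *\<^sub>R y) - t * p y) ` {0..})" for x
    by (rule bdd_belowI2[where m = "- p (- x)"]) (use low in auto)
  have le: "q x \<le> p (x + t *\<^sub>R y) - t * p y" if "t \<ge> 0" for x t
    unfolding q_def by (rule cINF_lower[OF bdd]) (use that in auto)
  have ge: "m \<le> q x" if "\<And>t. t \<ge> 0 \<Longrightarrow> m \<le> p (x + t *\<^sub>R y) - t * p y" for m x
    unfolding q_def by (rule cINF_greatest) (use that in auto)
  show "q x \<le> p x" for x using le[of 0 x] by simp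
  show "q (- y) \<le> - p y" using le[of 1 "- y"] sublinearD(3)[OF p] by simp
  show "sublinear q"
  proof (rule sublinearI)
    fix x z
    have "q (x + z) - (p (x + t *\<^sub>R y) - t * p y) \<le> p (z + s *\<^sub>R y) - s * p y"
      if "t \<ge> 0" "s \<ge> 0" for t s
      using le[of "t + s" "x + z"] that
        sublinearD(1)[OF p, of "x + t *\<^sub>R y" "z + s *\<^sub>R y"]
      by (simp add: algebra_simps)
    then have "q (x + z) - q z \<le> p (x + t *\<^sub>R y) - t * p y" if "t \<ge> 0" for t
      using ge[of "q (x + z) - (p (x + t *\<^sub>R y) - t * p y)" z] that by fastforce
    then have "q (x + z) - q z \<le> q x" by (rule ge)
    then show "q (x + z) \<le> q x + q z" by simp
  next
    show "q 0 = 0"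
    proof (rule antisym)
      show "q 0 \<le> 0" using le[of 0 0] sublinearD(3)[OF p] by simp
      show "0 \<le> q 0" by (rule ge) (simp add: sublinearD(2)[OF p])
    qed
  next
    fix r :: real and x assume r: "r > 0"
    have "q (r *\<^sub>R x) / r \<le> p (x + t *\<^sub>R y) - t * p y" if t: "t \<ge> 0" for t
    proof -
      have "q (r *\<^sub>R x) \<le> p (r *\<^sub>R (x + t *\<^sub>R y)) - (r * t) * p y"
        using le[of "r * t" "r *\<^sub>R x"] r t by (simp add: scaleR_add_right)
      also have "\<dots> = r * (p (x + t *\<^sub>R y) - t * p y)"
        using sublinearD(2)[OF p, of r "x + t *\<^sub>R y"] r by (simp add: algebra_simps)
      finally show ?thesis using r by (simp add: field_simps)
    qed
    then have "q (r *\<^sub>R x) / r \<le> q x" by (rule ge)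
    then show "q (r *\<^sub>R x) \<le> r * q x" using r by (simp add: field_simps)
  qed
qed

lemma sublinear_chain_lower_bound:
  fixes p :: "'a::real_vector \<Rightarrow> real"
  assumes C: "C \<noteq> {}" "\<And>q. q \<in> C \<Longrightarrow> sublinear q \<and> (\<forall>x. q x \<le> p x)"
    and chain: "\<And>q q'. q \<in> C \<Longrightarrow> q' \<in> C \<Longrightarrow> (\<forall>x. q x \<le> q' x) \<or> (\<forall>x. q' x \<le> q x)"
  obtains u where "sublinear u" "\<And>q x. q \<in> C \<Longrightarrow> u x \<le> q x"
proof
  define u where "u x = (INF q\<in>C. q x)" for x
  have low: "- p (- x) \<le> q x" if "q \<in> C" for q x
    using sublinearD(4)[of q x] C(2)[OF that] by (meson dual_order.trans neg_le_iff_le)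
  have bdd: "bdd_below ((\<lambda>q. q x) ` C)" for x
    by (rule bdd_belowI2[where m = "- p (- x)"]) (use low in auto)
  show le: "u x \<le> q x" if "q \<in> C" for q x
    unfolding u_def by (rule cINF_lower[OF bdd that])
  have ge: "m \<le> u x" if "\<And>q. q \<in> C \<Longrightarrow> m \<le> q x" for m x
    unfolding u_def by (rule cINF_greatest[OF C(1)]) (use that in auto)
  show "sublinear u"
  proof (rule sublinearI)
    fix x z
    have *: "u (x + z) - q x \<le> q' z" if q: "q \<in> C" "q' \<in> C" for q q'
      using chain[OF q]
    proof
      assume "\<forall>x. q x \<le> q' x"
      then have "q z \<le> q' z" by simp
      then show ?thesis
        using le[OF q(1), of "x + z"] C(2)[OF q(1)] sublinearD(1)[of q x z] by linarith
    next
      assume "\<forall>x. q' x \<le> q x"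
      then have "q' x \<le> q x" by simp
      then show ?thesis
        using le[OF q(2), of "x + z"] C(2)[OF q(2)] sublinearD(1)[of q' x z] by linarith
    qed
    have "u (x + z) - u z \<le> q x" if "q \<in> C" for q
    proof -
      have "u (x + z) - q x \<le> u z" by (rule ge) (use * that in auto)
      then show ?thesis by simp
    qed
    then have "u (x + z) - u z \<le> u x" by (rule ge)
    then show "u (x + z) \<le> u x + u z" by simp
  next
    have "q 0 = 0" if "q \<in> C" for q using C(2)[OF that] sublinearD(3) by blast
    then have "(\<lambda>q. q 0) ` C = {0}" using C(1) by force
    then show "u 0 = 0" by (simp add: u_def)
  next
    fix r :: real and x assume r: "r > 0"
    have "u (r *\<^sub>R x) / r \<le> q x" if q: "q \<in> C" for q
      using le[OF q, of "r *\<^sub>R x"] C(2)[OF q] sublinearD(2)[of q r x] r by (simp add: field_simps)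
    then have "u (r *\<^sub>R x) / r \<le> u x" by (rule ge)
    then show "u (r *\<^sub>R x) \<le> r * u x" using r by (simp add: field_simps)
  qed
qed

lemma minimal_sublinear_linear:
  fixes q :: "'a::real_vector \<Rightarrow> real"
  assumes q: "sublinear q" and min: "\<And>q'. sublinear q' \<Longrightarrow> (\<And>x. q' x \<le> q x) \<Longrightarrow> q' = q"
  shows "linear q"
proof -
  have neg: "q (- y) = - q y" for y
  proof -
    obtain q' where q': "sublinear q'" "\<And>x. q' x \<le> q x" "q' (- y) \<le> - q y"
      using sublinear_shrink[OF q, of y] by blast
    with min have "q' = q" by blast
    with q'(3) sublinearD(4)[OF q, of y] show ?thesis by simp
  qed
  have add: "q (x + y) = q x + q y" for x y
  proof (rule antisym)
    show "q (x + y) \<le> q x + q y" by (rule sublinearD(1)[OF q])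
    show "q x + q y \<le> q (x + y)"
      using sublinearD(1)[OF q, of "- x" "- y"] neg[of x] neg[of y] neg[of "x + y"] by simp
  qed
  have "q (r *\<^sub>R x) = r *\<^sub>R q x" for r x
  proof (cases "r \<ge> 0")
    case True
    then show ?thesis by (simp add: sublinearD(2)[OF q])
  next
    case False
    then have "q ((- r) *\<^sub>R x) = (- r) * q x" by (intro sublinearD(2)[OF q]) simp
    then show ?thesis using neg[of "r *\<^sub>R x"] by simp
  qed
  with add show ?thesis by (rule linearI)
qed

theorem Hahn_Banach_real:
  fixes p :: "'a::real_vector \<Rightarrow> real"
  assumes p: "sublinear p"
  obtains g where "linear g" "\<And>x. g x \<le> p x" "g x0 = p x0"
proof -
  obtain p' where p': "sublinear p'" "\<And>x. p' x \<le> p x" "p' (- x0) \<le> - p x0"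
    using sublinear_shrink[OF p, of x0] by blast
  define A where "A = {q. sublinear q \<and> (\<forall>x. q x \<le> p' x)}"
  define P where "P = (\<lambda>q q' :: 'a \<Rightarrow> real. \<forall>x. q' x \<le> q x)"
  have "\<exists>m\<in>A. \<forall>q\<in>A. P m q \<longrightarrow> q = m"
  proof (rule predicate_Zorn)
    show "partial_order_on A (relation_of P A)"
    proof (rule partial_order_on_relation_ofI)
      show "P a a" for a by (simp add: P_def)
      show "P a b \<Longrightarrow> P b c \<Longrightarrow> P a c" for a b c
        unfolding P_def by (meson order_trans)
      show "P a b \<Longrightarrow> P b a \<Longrightarrow> a = b" for a b
        unfolding P_def by (intro ext antisym) auto
    qed
    fix C assume C: "C \<in> Chains (relation_of P A)"
    then have CA: "C \<subseteq> A" by (auto simp: Chains_def relation_of_def)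
    show "\<exists>u\<in>A. \<forall>a\<in>C. P a u"
    proof (cases "C = {}")
      case True
      have "p' \<in> A" using p'(1) by (simp add: A_def)
      with True show ?thesis by blast
    next
      case False
      have 1: "sublinear q \<and> (\<forall>x. q x \<le> p' x)" if "q \<in> C" for q
        using that CA by (auto simp: A_def)
      have 2: "(\<forall>x. q x \<le> q' x) \<or> (\<forall>x. q' x \<le> q x)" if "q \<in> C" "q' \<in> C" for q q'
        using that C by (auto simp: Chains_def relation_of_def P_def)
      obtain u where u: "sublinear u" "\<And>q x. q \<in> C \<Longrightarrow> u x \<le> q x"
        using sublinear_chain_lower_bound[of C p', OF False 1 2] by blast
      obtain q where q: "q \<in> C" using False by blast
      have "u x \<le> p' x" for x
        using u(2)[OF q, of x] q CA by (auto simp: A_def intro: order_trans)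
      then have "u \<in> A" using u(1) by (simp add: A_def)
      then show ?thesis using u(2) by (auto simp: P_def)
    qed
  qed
  then obtain g where g: "g \<in> A" "\<And>q. q \<in> A \<Longrightarrow> P g q \<Longrightarrow> q = g" by blast
  have gp: "g x \<le> p' x" for x using g(1) by (simp add: A_def)
  have lin: "linear g"
  proof (rule minimal_sublinear_linear)
    show "sublinear g" using g(1) by (simp add: A_def)
    fix q assume q: "sublinear q" "\<And>x. q x \<le> g x"
    have "q x \<le> p' x" for x using q(2)[of x] gp[of x] by linarith
    with q show "q = g" by (intro g(2)) (auto simp: A_def P_def)
  qed
  show thesis
  proof
    show "linear g" by (rule lin)
    show le: "g x \<le> p x" for x using gp[of x] p'(2)[of x] by linarith
    have "- g x0 \<le> - p x0"
      using gp[of "- x0"] p'(3) linear_neg[OF lin, of x0] by simp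
    with le[of x0] show "g x0 = p x0" by simp
  qed
qed

text \<open>The complex functional with prescribed real part.\<close>

definition complexify :: "('a::complex_normed_vector \<Rightarrow> real) \<Rightarrow> 'a \<Rightarrow> complex"
  where "complexify g x = Complex (g x) (- g (\<i> *\<^sub>C x))"

lemma scaleC_Complex: "c *\<^sub>C x = Re c *\<^sub>R x + Im c *\<^sub>R (\<i> *\<^sub>C (x::'a::complex_normed_vector))"
proof -
  have "c *\<^sub>C x = (complex_of_real (Re c) + complex_of_real (Im c) * \<i>) *\<^sub>C x"
    using complex_eq[of c] by (simp add: mult.commute)
  then show ?thesis by (simp only: scaleC_add_left scaleC_scaleC[symmetric] scaleC_of_real)
qed

lemma complexify_linear:
  assumes "linear g"
  shows "complexify g (x + y) = complexify g x + complexify g y"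
    and "complexify g (c *\<^sub>C x) = c * complexify g x"
proof -
  interpret linear g by (rule assms)
  show "complexify g (x + y) = complexify g x + complexify g y"
    by (simp add: complexify_def complex_eq_iff scaleC_add_right add)
  have ii: "\<i> *\<^sub>C \<i> *\<^sub>C x = - x"
    using scaleC_of_real[of "- 1" x] by (simp add: scaleC_scaleC)
  have "g (c *\<^sub>C x) = Re c * g x + Im c * g (\<i> *\<^sub>C x)"
    by (subst scaleC_Complex) (simp add: add scaleR)
  moreover have "g (\<i> *\<^sub>C c *\<^sub>C x) = Re c * g (\<i> *\<^sub>C x) - Im c * g x"
    by (subst (2) scaleC_Complex)
       (simp add: scaleC_add_right scaleC_scaleR_commute ii diff scaleR)
  ultimately show "complexify g (c *\<^sub>C x) = c * complexify g x"
    by (simp add: complexify_def complex_eq_iff)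
qed

lemma cmod_complexify_le:
  assumes g: "linear g" and le: "\<And>c. cmod c = 1 \<Longrightarrow> g (c *\<^sub>C x) \<le> b"
  shows "cmod (complexify g x) \<le> b"
proof -
  define z where "z = complexify g x"
  obtain c where c: "cmod c = 1" "c * z = complex_of_real (cmod z)"
  proof (cases "z = 0")
    case True
    then show ?thesis by (intro that[of 1]) auto
  next
    case False
    then show ?thesis
      by (intro that[of "cnj z / complex_of_real (cmod z)"])
         (auto simp: norm_divide complex_norm_square[symmetric] power2_eq_square mult.commute)
  qed
  have "complexify g (c *\<^sub>C x) = complex_of_real (cmod z)"
    by (simp add: complexify_linear(2)[OF g] c(2)[unfolded z_def] z_def)
  then have "g (c *\<^sub>C x) = cmod z"
    by (simp add: complexify_def complex_eq_iff)
  with le[OF c(1)] show ?thesis by (simp add: z_def)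
qed

lemma dual_norming:
  fixes x :: "'a::complex_normed_vector"
  obtains f :: "'a dual" where "norm f \<le> 1" "cblinfun_apply f x = complex_of_real (norm x)"
proof -
  have "sublinear (norm :: 'a \<Rightarrow> real)"
    by (simp add: sublinear_def norm_triangle_ineq)
  then obtain g :: "'a \<Rightarrow> real" where g: "linear g" "\<And>y. g y \<le> norm y" "g x = norm x"
    using Hahn_Banach_real[of norm x] by blast
  have le: "cmod (complexify g y) \<le> norm y" for y
    by (rule cmod_complexify_le[OF g(1)]) (use g(2) in \<open>metis norm_scaleC mult_1\<close>)
  have bc: "bounded_clinear (complexify g)"
    by (rule bounded_clinear_intro[where K = 1])
       (simp_all add: complexify_linear[OF g(1)] le)
  have ap: "cblinfun_apply (CBlinfun (complexify g)) = complexify g"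
    by (rule CBlinfun_inverse[OF bc])
  show thesis
  proof
    show "norm (CBlinfun (complexify g)) \<le> 1"
      by (rule norm_cblinfun_bound) (simp_all add: ap le)
    have re: "Re (complexify g x) = norm x" by (simp add: complexify_def g(3))
    have "(Re (complexify g x))\<^sup>2 + (Im (complexify g x))\<^sup>2 \<le> (norm x)\<^sup>2"
      using le[of x] by (simp add: cmod_power2[symmetric] power_mono)
    then have "Im (complexify g x) = 0" by (simp add: re)
    with re show "cblinfun_apply (CBlinfun (complexify g)) x = complex_of_real (norm x)"
      by (simp add: ap complex_eq_iff)
  qed
qed

section \<open>Adjoints, biduals, and the first Arens product\<close>

lemma CBlinfun_bound:
  assumes "bounded_clinear f" "0 \<le> b" "\<And>x. norm (f x) \<le> b * norm x"
  shows "norm (CBlinfun f) \<le> b"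
  by (rule norm_cblinfun_bound) (simp_all add: CBlinfun_inverse assms)

definition cblinfun_compose ::
    "('b::complex_normed_vector \<Rightarrow>\<^sub>C\<^sub>L 'c::complex_normed_vector) \<Rightarrow>
     ('a::complex_normed_vector \<Rightarrow>\<^sub>C\<^sub>L 'b) \<Rightarrow> 'a \<Rightarrow>\<^sub>C\<^sub>L 'c" (infixl "o\<^sub>C\<^sub>L" 55)
  where "f o\<^sub>C\<^sub>L g = CBlinfun (\<lambda>x. f (g x))"

lemma bounded_clinear_compose:
  "bounded_clinear f \<Longrightarrow> bounded_clinear g \<Longrightarrow> bounded_clinear (\<lambda>x. f (g x))"
  by (simp add: bounded_clinear_def bounded_linear_compose)

lemma cblinfun_compose_apply [simp]: "cblinfun_apply (f o\<^sub>C\<^sub>L g) x = f (g x)"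
  by (simp add: cblinfun_compose_def CBlinfun_inverse bounded_clinear_compose
      bounded_clinear_cblinfun_apply)

lemma norm_cblinfun_compose: "norm (f o\<^sub>C\<^sub>L g) \<le> norm f * norm g"
proof (rule norm_cblinfun_bound)
  fix x
  have "norm (f (g x)) \<le> norm f * norm (g x)" by (rule norm_cblinfun_le)
  also have "\<dots> \<le> norm f * (norm g * norm x)"
    by (intro mult_left_mono norm_cblinfun_le norm_ge_zero)
  finally show "norm (cblinfun_apply (f o\<^sub>C\<^sub>L g) x) \<le> norm f * norm g * norm x"
    by (simp add: mult.assoc)
qed simp

definition cadjoint ::
    "('a::complex_normed_vector \<Rightarrow>\<^sub>C\<^sub>L 'b::complex_normed_vector) \<Rightarrow> 'b dual \<Rightarrow>\<^sub>C\<^sub>L 'a dual"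
  where "cadjoint T = CBlinfun (\<lambda>f. f o\<^sub>C\<^sub>L T)"

lemma bounded_clinear_cadjoint: "bounded_clinear (\<lambda>f :: 'b::complex_normed_vector \<Rightarrow>\<^sub>C\<^sub>L
    'c::complex_normed_vector. f o\<^sub>C\<^sub>L (T :: 'a::complex_normed_vector \<Rightarrow>\<^sub>C\<^sub>L 'b))"
  by (rule bounded_clinear_intro[where K = "norm T"])
     (auto intro!: cblinfun_eqI simp: cblinfun_ops_apply norm_cblinfun_compose)

lemma cadjoint_apply [simp]: "cblinfun_apply (cadjoint T) f = f o\<^sub>C\<^sub>L T"
  by (simp add: cadjoint_def CBlinfun_inverse bounded_clinear_cadjoint)

text \<open>
  Duals of bimodules.  A left (right) module action on a Banach space is given by
  the family of operators \<open>x \<mapsto> a \<cdot> x\<close> (resp. \<open>x \<mapsto> x \<cdot> a\<close>) indexed by the algebra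
  element \<open>a\<close>.  On the dual, \<open>(a \<cdot> f)(x) = f(x \<cdot> a)\<close> and \<open>(f \<cdot> a)(x) = f(a \<cdot> x)\<close>.
\<close>

definition dual_left_action ::
    "('c \<Rightarrow> ('x::complex_normed_vector \<Rightarrow>\<^sub>C\<^sub>L 'x)) \<Rightarrow> 'c \<Rightarrow> ('x dual \<Rightarrow>\<^sub>C\<^sub>L 'x dual)"
  where "dual_left_action right a = cadjoint (right a)"

definition dual_right_action ::
    "('c \<Rightarrow> ('x::complex_normed_vector \<Rightarrow>\<^sub>C\<^sub>L 'x)) \<Rightarrow> 'c \<Rightarrow> ('x dual \<Rightarrow>\<^sub>C\<^sub>L 'x dual)"
  where "dual_right_action left a = cadjoint (left a)"

lemma dual_action_apply:
  "cblinfun_apply (cblinfun_apply (dual_left_action right a) f) x = f (right a x)"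
  "cblinfun_apply (cblinfun_apply (dual_right_action left a) f) x = f (left a x)"
  by (simp_all add: dual_left_action_def dual_right_action_def)

definition lmult :: "'a::complex_banach_algebra \<Rightarrow> ('a \<Rightarrow>\<^sub>C\<^sub>L 'a)"
  where "lmult a = CBlinfun (\<lambda>b. a * b)"

lemma lmult_apply [simp]: "cblinfun_apply (lmult a) b = a * b"
proof -
  have "bounded_clinear (\<lambda>b. a * b)"
  proof (rule bounded_clinear_intro[where K = "norm a"])
    show "norm (a * b) \<le> norm b * norm a" for b
      using norm_mult_ineq[of a b] by (simp only: mult.commute[of "norm b" "norm a"])
  qed (simp_all add: distrib_left scaleC_mult_right)
  then show ?thesis by (simp add: lmult_def CBlinfun_inverse)
qed

text \<open>
  First Arens product: \<open>(f \<cdot> a)(b) = f(ab)\<close>, \<open>(G \<cdot> f)(a) = G(f \<cdot> a)\<close>,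
  \<open>(F \<box> G)(f) = F(G \<cdot> f)\<close>.
\<close>

definition arens_act :: "'a::complex_banach_algebra dual dual \<Rightarrow> 'a dual \<Rightarrow> 'a dual"
  where "arens_act G f = CBlinfun (\<lambda>a. G (dual_right_action lmult a f))"

definition arens :: "'a::complex_banach_algebra dual dual \<Rightarrow> 'a dual dual \<Rightarrow> 'a dual dual"
  where "arens F G = CBlinfun (\<lambda>f. F (arens_act G f))"

lemma dual_right_lmult_simps:
  fixes f g :: "'a::complex_banach_algebra dual"
  shows "dual_right_action lmult (a + b) f = dual_right_action lmult a f + dual_right_action lmult b f"
    and "dual_right_action lmult (c *\<^sub>C a) f = c *\<^sub>C dual_right_action lmult a f"
    and "norm (dual_right_action lmult a f) \<le> norm a * norm f"
    and "dual_right_action lmult (a * b) f = dual_right_action lmult b (dual_right_action lmult a f)"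
proof -
  show "dual_right_action lmult (a + b) f = dual_right_action lmult a f + dual_right_action lmult b f"
    by (rule cblinfun_eqI)
       (simp add: dual_action_apply cblinfun_ops_apply distrib_right cblinfun_right_simps)
  show "dual_right_action lmult (c *\<^sub>C a) f = c *\<^sub>C dual_right_action lmult a f"
    by (rule cblinfun_eqI)
       (simp add: dual_action_apply cblinfun_ops_apply scaleC_mult_left
         cblinfun_scaleC_right[of f, simplified])
  show "dual_right_action lmult (a * b) f = dual_right_action lmult b (dual_right_action lmult a f)"
    by (rule cblinfun_eqI) (simp add: dual_action_apply mult.assoc)
  show "norm (dual_right_action lmult a f) \<le> norm a * norm f"
  proof (rule norm_cblinfun_bound)
    fix x
    have "norm (f (a * x)) \<le> norm f * norm (a * x)" by (rule norm_cblinfun_le)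
    also have "\<dots> \<le> norm f * (norm a * norm x)"
      by (intro mult_left_mono norm_mult_ineq norm_ge_zero)
    finally show "norm (cblinfun_apply (dual_right_action lmult a f) x) \<le> norm a * norm f * norm x"
      by (simp add: dual_action_apply mult_ac)
  qed simp
qed

lemma norm_cblinfun_le':
  assumes "norm x \<le> b"
  shows "norm (cblinfun_apply f x) \<le> norm f * b"
  using norm_cblinfun_le[of f x] mult_left_mono[OF assms norm_ge_zero[of f]] by linarith

lemma bounded_clinear_arens_act:
  "bounded_clinear (\<lambda>a. cblinfun_apply G (dual_right_action lmult a f))"
proof (rule bounded_clinear_intro[where K = "norm G * norm f"])
  show "norm (cblinfun_apply G (dual_right_action lmult a f)) \<le> norm a * (norm G * norm f)" for a
    using norm_cblinfun_le'[OF dual_right_lmult_simps(3)[of a f], of G] by (simp add: mult_ac)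
qed (simp_all add: dual_right_lmult_simps cblinfun_right_simps cblinfun_scaleC_right[of G, simplified])

lemma arens_act_apply: "cblinfun_apply (arens_act G f) a = G (dual_right_action lmult a f)"
  by (simp add: arens_act_def CBlinfun_inverse bounded_clinear_arens_act)

lemma norm_arens_act: "norm (arens_act G f) \<le> norm G * norm f"
  unfolding arens_act_def
proof (rule CBlinfun_bound[OF bounded_clinear_arens_act])
  show "norm (cblinfun_apply G (dual_right_action lmult a f)) \<le> norm G * norm f * norm a" for a
    using norm_cblinfun_le'[OF dual_right_lmult_simps(3)[of a f], of G] by (simp add: mult_ac)
qed simp

lemma arens_act_simps:
  "arens_act G (f + g) = arens_act G f + arens_act G g"
  "arens_act G (c *\<^sub>C f) = c *\<^sub>C arens_act G f"
  "arens_act (G + H) f = arens_act G f + arens_act H f"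
  "arens_act (c *\<^sub>C G) f = c *\<^sub>C arens_act G f"
  by (rule cblinfun_eqI, simp add: arens_act_apply cblinfun_ops_apply cblinfun_right_simps
      cblinfun_scaleC_right[of G, simplified]
      cblinfun_scaleC_right[of "dual_right_action lmult a" for a, simplified])+

lemma bounded_clinear_arens: "bounded_clinear (\<lambda>f. cblinfun_apply F (arens_act G f))"
proof (rule bounded_clinear_intro[where K = "norm F * norm G"])
  show "norm (cblinfun_apply F (arens_act G f)) \<le> norm f * (norm F * norm G)" for f
    using norm_cblinfun_le'[OF norm_arens_act[of G f], of F] by (simp add: mult_ac)
qed (simp_all add: arens_act_simps cblinfun_right_simps cblinfun_scaleC_right[of F, simplified])

lemma arens_apply: "cblinfun_apply (arens F G) f = F (arens_act G f)"
  by (simp add: arens_def CBlinfun_inverse bounded_clinear_arens)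

lemma norm_arens: "norm (arens F G) \<le> norm F * norm G"
  unfolding arens_def
proof (rule CBlinfun_bound[OF bounded_clinear_arens])
  show "norm (cblinfun_apply F (arens_act G f)) \<le> norm F * norm G * norm f" for f
    using norm_cblinfun_le'[OF norm_arens_act[of G f], of F] by (simp add: mult_ac)
qed simp

lemma arens_simps:
  "arens (F + G) H = arens F H + arens G H"
  "arens H (F + G) = arens H F + arens H G"
  "arens (c *\<^sub>C F) G = c *\<^sub>C arens F G"
  "arens F (c *\<^sub>C G) = c *\<^sub>C arens F G"
  by (rule cblinfun_eqI, simp add: arens_apply arens_act_simps cblinfun_ops_apply
      cblinfun_right_simps cblinfun_scaleC_right[of F, simplified])+

lemma arens_assoc: "arens (arens F G) H = arens F (arens G H)"
proof (rule cblinfun_eqI)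
  fix f
  have "arens_act (arens G H) f = arens_act G (arens_act H f)"
  proof (rule cblinfun_eqI)
    fix a
    have "arens_act H (dual_right_action lmult a f) = dual_right_action lmult a (arens_act H f)"
      by (rule cblinfun_eqI)
         (simp add: arens_act_apply dual_action_apply dual_right_lmult_simps(4))
    then show "cblinfun_apply (arens_act (arens G H) f) a = arens_act G (arens_act H f) a"
      by (simp add: arens_act_apply arens_apply)
  qed
  then show "cblinfun_apply (arens (arens F G) H) f = arens F (arens G H) f"
    by (simp add: arens_apply)
qed

text \<open>A copy of the bidual, so that it can carry the algebra structure.\<close>

typedef (overloaded) 'a bidual = "UNIV :: 'a::complex_banach_algebra dual dual set"
  morphisms of_bidual to_bidual ..

lemma of_to_bidual [simp]: "of_bidual (to_bidual F) = F"
  by (simp add: to_bidual_inverse)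

instantiation bidual :: (complex_banach_algebra) complex_normed_vector
begin

definition norm_bidual :: "'a bidual \<Rightarrow> real"
  where "norm_bidual F = norm (of_bidual F)"
definition zero_bidual :: "'a bidual"
  where "zero_bidual = to_bidual 0"
definition plus_bidual :: "'a bidual \<Rightarrow> 'a bidual \<Rightarrow> 'a bidual"
  where "plus_bidual F G = to_bidual (of_bidual F + of_bidual G)"
definition minus_bidual :: "'a bidual \<Rightarrow> 'a bidual \<Rightarrow> 'a bidual"
  where "minus_bidual F G = to_bidual (of_bidual F - of_bidual G)"
definition uminus_bidual :: "'a bidual \<Rightarrow> 'a bidual"
  where "uminus_bidual F = to_bidual (- of_bidual F)"
definition scaleR_bidual :: "real \<Rightarrow> 'a bidual \<Rightarrow> 'a bidual"
  where "scaleR_bidual r F = to_bidual (r *\<^sub>R of_bidual F)"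
definition scaleC_bidual :: "complex \<Rightarrow> 'a bidual \<Rightarrow> 'a bidual"
  where "scaleC_bidual c F = to_bidual (c *\<^sub>C of_bidual F)"
definition sgn_bidual :: "'a bidual \<Rightarrow> 'a bidual"
  where "sgn_bidual F = inverse (norm F) *\<^sub>R F"
definition dist_bidual :: "'a bidual \<Rightarrow> 'a bidual \<Rightarrow> real"
  where "dist_bidual F G = norm (F - G)"
definition uniformity_bidual :: "('a bidual \<times> 'a bidual) filter"
  where "uniformity_bidual = (INF e\<in>{0<..}. principal {(x, y). dist x y < e})"
definition open_bidual :: "'a bidual set \<Rightarrow> bool"
  where "open_bidual S = (\<forall>x\<in>S. \<forall>\<^sub>F (x', y) in uniformity. x' = x \<longrightarrow> y \<in> S)"

lemma of_bidual_ops: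
  fixes F G :: "'a bidual"
  shows "of_bidual (0 :: 'a bidual) = 0"
    and "of_bidual (F + G) = of_bidual F + of_bidual G"
    and "of_bidual (F - G) = of_bidual F - of_bidual G"
    and "of_bidual (- F) = - of_bidual F"
    and "of_bidual (r *\<^sub>R F) = r *\<^sub>R of_bidual F"
    and "of_bidual (c *\<^sub>C F) = c *\<^sub>C of_bidual F"
  by (simp_all add: zero_bidual_def plus_bidual_def minus_bidual_def uminus_bidual_def
      scaleR_bidual_def scaleC_bidual_def)

instance
proof
  fix F G H :: "'a bidual" and r s :: real and c d :: complex
  note eq = of_bidual_inject[symmetric]
  show "F + G + H = F + (G + H)" "F + G = G + F" "0 + F = F" "- F + F = 0" "F - G = F + - G"
    "r *\<^sub>R (F + G) = r *\<^sub>R F + r *\<^sub>R G" "(r + s) *\<^sub>R F = r *\<^sub>R F + s *\<^sub>R F"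
    "r *\<^sub>R s *\<^sub>R F = (r * s) *\<^sub>R F" "1 *\<^sub>R F = F"
    "c *\<^sub>C (F + G) = c *\<^sub>C F + c *\<^sub>C G" "(c + d) *\<^sub>C F = c *\<^sub>C F + d *\<^sub>C F"
    "c *\<^sub>C d *\<^sub>C F = (c * d) *\<^sub>C F" "complex_of_real r *\<^sub>C F = r *\<^sub>R F"
    by (simp_all add: eq of_bidual_ops scaleR_add_left scaleR_add_right
        scaleC_add_right scaleC_add_left scaleC_scaleC scaleC_of_real ac_simps)
  show "(norm F = 0) = (F = 0)"
    by (simp add: norm_bidual_def eq of_bidual_ops)
  show "norm (F + G) \<le> norm F + norm G"
    by (simp add: norm_bidual_def of_bidual_ops norm_triangle_ineq)
  show "norm (r *\<^sub>R F) = \<bar>r\<bar> * norm F" "norm (c *\<^sub>C F) = cmod c * norm F"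
    by (simp_all add: norm_bidual_def of_bidual_ops norm_scaleC)
qed (rule sgn_bidual_def dist_bidual_def uniformity_bidual_def open_bidual_def)+

end

instance bidual :: (complex_banach_algebra) complex_banach
proof
  fix X :: "nat \<Rightarrow> 'a bidual"
  assume "Cauchy X"
  moreover have "range (of_bidual :: 'a bidual \<Rightarrow> _) = UNIV"
    by (rule type_definition.Rep_range[OF type_definition_bidual])
  ultimately show "convergent X"
    by (intro complete_via_Rep[where Rep = of_bidual])
       (simp_all add: norm_bidual_def of_bidual_ops)
qed

instantiation bidual :: (complex_banach_algebra) complex_banach_algebra
begin

definition times_bidual :: "'a bidual \<Rightarrow> 'a bidual \<Rightarrow> 'a bidual"
  where "times_bidual F G = to_bidual (arens (of_bidual F) (of_bidual G))"

lemma of_bidual_times: "of_bidual (F * G :: 'a bidual) = arens (of_bidual F) (of_bidual G)"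
  by (simp add: times_bidual_def)

instance
proof
  fix F G H :: "'a bidual" and r :: real and c :: complex
  note eq = of_bidual_inject[symmetric]
  show "F * G * H = F * (G * H)" "(F + G) * H = F * H + G * H" "F * (G + H) = F * G + F * H"
    "(c *\<^sub>C F) * G = c *\<^sub>C (F * G)" "F * (c *\<^sub>C G) = c *\<^sub>C (F * G)"
    by (simp_all add: eq of_bidual_ops of_bidual_times arens_simps arens_assoc)
  show "(r *\<^sub>R F) * G = r *\<^sub>R (F * G)" "F * (r *\<^sub>R G) = r *\<^sub>R (F * G)"
    by (simp_all add: eq of_bidual_ops of_bidual_times arens_simps flip: scaleC_of_real)
  show "norm (F * G) \<le> norm F * norm G"
    by (simp add: norm_bidual_def of_bidual_times norm_arens)
qed

end

section \<open>The projective tensor product\<close>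

text \<open>
  The bounded bilinear forms on \<open>'a \<times> 'b\<close> are identified with the operators
  \<open>'a \<Rightarrow>\<^sub>C\<^sub>L 'b dual\<close>.  The elementary tensor of \<open>a\<close> and \<open>b\<close> is realised as evaluation of bilinear
  forms at \<open>(a, b)\<close>, and the projective tensor product is the closure of the linear span of
  the elementary tensors in the dual of the space of bounded bilinear forms (the span over the
  reals is already a complex subspace, because \<open>c(a \<otimes> b) = (ca) \<otimes> b\<close>).  That this is
  the completion of the algebraic tensor product in the projective norm is confirmed below by
  \<open>norm_ptensor\<close> (the norm is the projective norm), \<open>closure_span_tensor\<close> (density) and
  \<open>ptensor_universal\<close> (the universal property).
\<close>

definition tensor_form ::
    "'a::complex_normed_vector \<Rightarrow> 'b::complex_normed_vector \<Rightarrow> ('a \<Rightarrow>\<^sub>C\<^sub>L 'b dual) dual"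
  where "tensor_form a b = CBlinfun (\<lambda>B :: 'a \<Rightarrow>\<^sub>C\<^sub>L 'b dual. B a b)"

lemma norm_bilinear_form_le:
  fixes B :: "'a::complex_normed_vector \<Rightarrow>\<^sub>C\<^sub>L 'b::complex_normed_vector \<Rightarrow>\<^sub>C\<^sub>L 'c::complex_normed_vector"
  shows "norm (B a b) \<le> norm B * norm a * norm b"
  using norm_cblinfun_le[of "B a" b] mult_right_mono[OF norm_cblinfun_le[of B a] norm_ge_zero[of b]]
  by linarith

lemma tensor_form_apply: "cblinfun_apply (tensor_form a b) B = B a b"
proof -
  have "bounded_clinear (\<lambda>B :: 'a \<Rightarrow>\<^sub>C\<^sub>L 'b dual. B a b)"
    by (rule bounded_clinear_intro[where K = "norm a * norm b"])
       (simp_all add: cblinfun_ops_apply norm_bilinear_form_le flip: mult.assoc)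
  then show ?thesis by (simp add: tensor_form_def CBlinfun_inverse)
qed

lemma tensor_form_simps:
  "tensor_form (a + a') b = tensor_form a b + tensor_form a' b"
  "tensor_form a (b + b') = tensor_form a b + tensor_form a b'"
  "tensor_form (c *\<^sub>C a) b = c *\<^sub>C tensor_form a b"
  "tensor_form a (c *\<^sub>C b) = c *\<^sub>C tensor_form a b"
  by (rule cblinfun_eqI, simp add: tensor_form_apply cblinfun_ops_apply cblinfun_right_simps
      cblinfun_scaleC_right[where 'b = complex, simplified])+

definition ptensor_carrier ::
    "('a::complex_normed_vector \<Rightarrow>\<^sub>C\<^sub>L 'b::complex_normed_vector dual) dual set"
  where "ptensor_carrier = closure (span {tensor_form a b | a b. True})"

lemma in_closure_limit:
  "(\<And>n. f n \<in> S) \<Longrightarrow> f \<longlonglongrightarrow> x \<Longrightarrow> x \<in> closure (S :: 'a::real_normed_vector set)"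
  unfolding closure_sequential by blast

lemma closure_subspace:
  fixes S :: "'a::real_normed_vector set"
  assumes "subspace S" shows "subspace (closure S)"
proof (rule subspaceI)
  show "0 \<in> closure S" using subspace_0[OF assms] closure_subset by blast
  show "x + y \<in> closure S" if xy: "x \<in> closure S" "y \<in> closure S" for x y
  proof -
    obtain f g where fg: "\<And>n. f n \<in> S" "f \<longlonglongrightarrow> x" "\<And>n. g n \<in> S" "g \<longlonglongrightarrow> y"
      using xy unfolding closure_sequential by blast
    have "(\<lambda>n. f n + g n) \<longlonglongrightarrow> x + y" by (intro tendsto_add fg)
    moreover have "f n + g n \<in> S" for n by (intro subspace_add[OF assms] fg)
    ultimately show ?thesis by (rule in_closure_limit[rotated])
  qed
  show "c *\<^sub>R x \<in> closure S" if x: "x \<in> closure S" for c x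
  proof -
    obtain f where f: "\<And>n. f n \<in> S" "f \<longlonglongrightarrow> x"
      using x unfolding closure_sequential by blast
    have "(\<lambda>n. c *\<^sub>R f n) \<longlonglongrightarrow> c *\<^sub>R x" by (intro tendsto_scaleR tendsto_const f)
    moreover have "c *\<^sub>R f n \<in> S" for n by (intro subspace_scale[OF assms] f)
    ultimately show ?thesis by (rule in_closure_limit[rotated])
  qed
qed

lemma scaleC_span:
  fixes S :: "'a::complex_normed_vector set"
  assumes S: "\<And>c x. x \<in> S \<Longrightarrow> c *\<^sub>C x \<in> S" and x: "x \<in> span S"
  shows "c *\<^sub>C x \<in> span S"
  using x
proof (induction rule: span_induct_alt)
  case base
  then show ?case by (simp add: span_zero)
next
  case (step r x y)
  then show ?case
    by (simp add: scaleC_add_right scaleC_scaleR_commute span_add span_scale span_base S)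
qed

lemma tensor_form_span_scaleC:
  "u \<in> span {tensor_form a b | a b. True} \<Longrightarrow> c *\<^sub>C u \<in> span {tensor_form a b | a b. True}"
  by (rule scaleC_span) (auto, metis tensor_form_simps(3))

lemma ptensor_carrier_closed:
  shows "subspace (ptensor_carrier ::
      ('a::complex_normed_vector \<Rightarrow>\<^sub>C\<^sub>L 'b::complex_normed_vector dual) dual set)"
    and "closed (ptensor_carrier :: ('a \<Rightarrow>\<^sub>C\<^sub>L 'b dual) dual set)"
    and "u \<in> (ptensor_carrier :: ('a \<Rightarrow>\<^sub>C\<^sub>L 'b dual) dual set) \<Longrightarrow> c *\<^sub>C u \<in> ptensor_carrier"
    and "tensor_form a b \<in> (ptensor_carrier :: ('a \<Rightarrow>\<^sub>C\<^sub>L 'b dual) dual set)"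
proof -
  show "subspace (ptensor_carrier :: ('a \<Rightarrow>\<^sub>C\<^sub>L 'b dual) dual set)"
    unfolding ptensor_carrier_def by (intro closure_subspace subspace_span)
  show "closed (ptensor_carrier :: ('a \<Rightarrow>\<^sub>C\<^sub>L 'b dual) dual set)"
    by (simp add: ptensor_carrier_def)
  show "tensor_form a b \<in> (ptensor_carrier :: ('a \<Rightarrow>\<^sub>C\<^sub>L 'b dual) dual set)"
    unfolding ptensor_carrier_def by (rule subsetD[OF closure_subset]) (auto intro: span_base)
  assume "u \<in> (ptensor_carrier :: ('a \<Rightarrow>\<^sub>C\<^sub>L 'b dual) dual set)"
  then obtain f where f: "\<And>n. f n \<in> span {tensor_form a b | (a :: 'a) (b :: 'b). True}" "f \<longlonglongrightarrow> u"
    unfolding ptensor_carrier_def closure_sequential by blast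
  have "(\<lambda>n. c *\<^sub>C f n) \<longlonglongrightarrow> c *\<^sub>C u"
    by (rule bounded_linear.tendsto[OF bounded_linear_scaleC f(2)])
  then show "c *\<^sub>C u \<in> ptensor_carrier"
    unfolding ptensor_carrier_def
    by (rule in_closure_limit[rotated]) (rule tensor_form_span_scaleC[OF f(1)])
qed

typedef (overloaded) ('a, 'b) ptensor  ("(_ \<otimes>\<^sub>p/ _)" [27, 26] 26) =
  "ptensor_carrier :: ('a::complex_normed_vector \<Rightarrow>\<^sub>C\<^sub>L 'b::complex_normed_vector dual) dual set"
  using ptensor_carrier_closed(4) by blast

instantiation ptensor :: (complex_normed_vector, complex_normed_vector) complex_normed_vector
begin

definition norm_ptensor :: "'a \<otimes>\<^sub>p 'b \<Rightarrow> real"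
  where "norm_ptensor u = norm (Rep_ptensor u)"
definition zero_ptensor :: "'a \<otimes>\<^sub>p 'b"
  where "zero_ptensor = Abs_ptensor 0"
definition plus_ptensor :: "'a \<otimes>\<^sub>p 'b \<Rightarrow> 'a \<otimes>\<^sub>p 'b \<Rightarrow> 'a \<otimes>\<^sub>p 'b"
  where "plus_ptensor u v = Abs_ptensor (Rep_ptensor u + Rep_ptensor v)"
definition minus_ptensor :: "'a \<otimes>\<^sub>p 'b \<Rightarrow> 'a \<otimes>\<^sub>p 'b \<Rightarrow> 'a \<otimes>\<^sub>p 'b"
  where "minus_ptensor u v = Abs_ptensor (Rep_ptensor u - Rep_ptensor v)"
definition uminus_ptensor :: "'a \<otimes>\<^sub>p 'b \<Rightarrow> 'a \<otimes>\<^sub>p 'b"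
  where "uminus_ptensor u = Abs_ptensor (- Rep_ptensor u)"
definition scaleR_ptensor :: "real \<Rightarrow> 'a \<otimes>\<^sub>p 'b \<Rightarrow> 'a \<otimes>\<^sub>p 'b"
  where "scaleR_ptensor r u = Abs_ptensor (r *\<^sub>R Rep_ptensor u)"
definition scaleC_ptensor :: "complex \<Rightarrow> 'a \<otimes>\<^sub>p 'b \<Rightarrow> 'a \<otimes>\<^sub>p 'b"
  where "scaleC_ptensor c u = Abs_ptensor (c *\<^sub>C Rep_ptensor u)"
definition sgn_ptensor :: "'a \<otimes>\<^sub>p 'b \<Rightarrow> 'a \<otimes>\<^sub>p 'b"
  where "sgn_ptensor u = inverse (norm u) *\<^sub>R u"
definition dist_ptensor :: "'a \<otimes>\<^sub>p 'b \<Rightarrow> 'a \<otimes>\<^sub>p 'b \<Rightarrow> real"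
  where "dist_ptensor u v = norm (u - v)"
definition uniformity_ptensor :: "(('a \<otimes>\<^sub>p 'b) \<times> ('a \<otimes>\<^sub>p 'b)) filter"
  where "uniformity_ptensor = (INF e\<in>{0<..}. principal {(x, y). dist x y < e})"
definition open_ptensor :: "('a \<otimes>\<^sub>p 'b) set \<Rightarrow> bool"
  where "open_ptensor S = (\<forall>x\<in>S. \<forall>\<^sub>F (x', y) in uniformity. x' = x \<longrightarrow> y \<in> S)"

lemma Rep_ptensor_ops:
  fixes u v :: "'a \<otimes>\<^sub>p 'b"
  shows "Rep_ptensor (0 :: 'a \<otimes>\<^sub>p 'b) = 0"
    and "Rep_ptensor (u + v) = Rep_ptensor u + Rep_ptensor v"
    and "Rep_ptensor (u - v) = Rep_ptensor u - Rep_ptensor v"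
    and "Rep_ptensor (- u) = - Rep_ptensor u"
    and "Rep_ptensor (r *\<^sub>R u) = r *\<^sub>R Rep_ptensor u"
    and "Rep_ptensor (c *\<^sub>C u) = c *\<^sub>C Rep_ptensor u"
  using ptensor_carrier_closed(1)[where 'a = 'a and 'b = 'b] Rep_ptensor[of u] Rep_ptensor[of v]
  by (simp_all add: zero_ptensor_def plus_ptensor_def minus_ptensor_def uminus_ptensor_def
      scaleR_ptensor_def scaleC_ptensor_def Abs_ptensor_inverse subspace_0 subspace_add
      subspace_diff subspace_neg subspace_scale ptensor_carrier_closed(3))

instance
proof
  fix F G H :: "'a \<otimes>\<^sub>p 'b" and r s :: real and c d :: complex
  note eq = Rep_ptensor_inject[symmetric]
  show "F + G + H = F + (G + H)" "F + G = G + F" "0 + F = F" "- F + F = 0" "F - G = F + - G"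
    "r *\<^sub>R (F + G) = r *\<^sub>R F + r *\<^sub>R G" "(r + s) *\<^sub>R F = r *\<^sub>R F + s *\<^sub>R F"
    "r *\<^sub>R s *\<^sub>R F = (r * s) *\<^sub>R F" "1 *\<^sub>R F = F"
    "c *\<^sub>C (F + G) = c *\<^sub>C F + c *\<^sub>C G" "(c + d) *\<^sub>C F = c *\<^sub>C F + d *\<^sub>C F"
    "c *\<^sub>C d *\<^sub>C F = (c * d) *\<^sub>C F" "complex_of_real r *\<^sub>C F = r *\<^sub>R F"
    by (simp_all add: eq Rep_ptensor_ops scaleR_add_left scaleR_add_right
        scaleC_add_right scaleC_add_left scaleC_scaleC scaleC_of_real ac_simps)
  show "(norm F = 0) = (F = 0)"
    by (simp add: norm_ptensor_def eq Rep_ptensor_ops)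
  show "norm (F + G) \<le> norm F + norm G"
    by (simp add: norm_ptensor_def Rep_ptensor_ops norm_triangle_ineq)
  show "norm (r *\<^sub>R F) = \<bar>r\<bar> * norm F" "norm (c *\<^sub>C F) = cmod c * norm F"
    by (simp_all add: norm_ptensor_def Rep_ptensor_ops norm_scaleC)
qed (rule sgn_ptensor_def dist_ptensor_def uniformity_ptensor_def open_ptensor_def)+

end

instance ptensor :: (complex_normed_vector, complex_normed_vector) complex_banach
proof
  fix X :: "nat \<Rightarrow> 'a \<otimes>\<^sub>p 'b"
  assume "Cauchy X"
  moreover have "range (Rep_ptensor :: 'a \<otimes>\<^sub>p 'b \<Rightarrow> _) = ptensor_carrier"
    by (rule type_definition.Rep_range[OF type_definition_ptensor])
  ultimately show "convergent X"
    by (intro complete_via_Rep[where Rep = Rep_ptensor])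
       (simp_all add: norm_ptensor_def Rep_ptensor_ops ptensor_carrier_closed(2))
qed

definition tensor :: "'a::complex_normed_vector \<Rightarrow> 'b::complex_normed_vector \<Rightarrow> 'a \<otimes>\<^sub>p 'b"
    (infixl "\<otimes>" 70)
  where "a \<otimes> b = Abs_ptensor (tensor_form a b)"

lemma Rep_tensor: "Rep_ptensor (a \<otimes> b) = tensor_form a b"
  by (simp add: tensor_def Abs_ptensor_inverse ptensor_carrier_closed(4))

lemma tensor_simps:
  "(a + a') \<otimes> b = a \<otimes> b + a' \<otimes> b" "a \<otimes> (b + b') = a \<otimes> b + a \<otimes> b'"
  "(c *\<^sub>C a) \<otimes> b = c *\<^sub>C (a \<otimes> b)" "a \<otimes> (c *\<^sub>C b) = c *\<^sub>C (a \<otimes> b)"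
  by (simp_all add: Rep_ptensor_inject[symmetric] Rep_tensor Rep_ptensor_ops tensor_form_simps)

lemma norm_tensor_le: "norm (a \<otimes> b) \<le> norm a * norm b"
  unfolding norm_ptensor_def Rep_tensor
  by (rule norm_cblinfun_bound)
     (use norm_bilinear_form_le in \<open>simp_all add: tensor_form_apply mult_ac\<close>)

lemma linear_Rep_ptensor: "linear Rep_ptensor"
  by (rule linearI) (simp_all add: Rep_ptensor_ops)

lemma tensor_span_scaleC:
  "u \<in> span {a \<otimes> b | a b. True} \<Longrightarrow> c *\<^sub>C u \<in> span {a \<otimes> b | a b. True}"
  by (rule scaleC_span) (auto, metis tensor_simps(3))

lemma closure_span_tensor:
  "closure (span {a \<otimes> b | a b. True})
    = (UNIV :: ('a::complex_normed_vector \<otimes>\<^sub>p 'b::complex_normed_vector) set)"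
proof -
  let ?T = "{a \<otimes> b | (a :: 'a) (b :: 'b). True}"
  let ?F = "{tensor_form a b | (a :: 'a) (b :: 'b). True}"
  have "Rep_ptensor ` ?T = ?F"
  proof -
    have "?T = (\<lambda>(a, b). a \<otimes> b) ` UNIV" "?F = (\<lambda>(a, b). tensor_form a b) ` UNIV" by auto
    then show ?thesis by (simp only: image_image Rep_tensor case_prod_unfold)
  qed
  then have im: "Rep_ptensor ` span ?T = span ?F"
    by (simp add: linear_span_image[OF linear_Rep_ptensor, symmetric])
  have "u \<in> closure (span ?T)" for u
  proof -
    have "Rep_ptensor u \<in> closure (span ?F)"
      using Rep_ptensor[of u] by (simp add: ptensor_carrier_def)
    then obtain f where f: "\<And>n. f n \<in> span ?F" "f \<longlonglongrightarrow> Rep_ptensor u"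
      unfolding closure_sequential by blast
    have "\<exists>v. v \<in> span ?T \<and> f n = Rep_ptensor v" for n
      using f(1)[of n] unfolding im[symmetric] by blast
    then obtain g where g: "\<And>n. g n \<in> span ?T" "\<And>n. f n = Rep_ptensor (g n)" by metis
    have "dist (Rep_ptensor v) (Rep_ptensor w) = dist v w" for v w :: "'a \<otimes>\<^sub>p 'b"
      by (simp add: dist_norm norm_ptensor_def Rep_ptensor_ops)
    then have "g \<longlonglongrightarrow> u" using f(2) by (simp add: lim_sequentially g(2))
    with g(1) show ?thesis unfolding closure_sequential by blast
  qed
  then show ?thesis by blast
qed

lemma ptensor_operator_eqI:
  fixes S T :: "'a::complex_normed_vector \<otimes>\<^sub>p 'b::complex_normed_vector \<Rightarrow>\<^sub>C\<^sub>L 'c::complex_normed_vector"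
  assumes eq: "\<And>a b. S (a \<otimes> b) = T (a \<otimes> b)"
  shows "S = T"
proof (rule cblinfun_eqI)
  fix u
  let ?E = "{u. cblinfun_apply S u = T u}"
  have "closed ?E"
    by (intro closed_Collect_eq linear_continuous_on bounded_linear_cblinfun)
  moreover have "span {a \<otimes> b | a b. True} \<subseteq> ?E"
    by (rule span_minimal) (auto simp: eq subspace_def cblinfun_right_simps)
  ultimately have "closure (span {a \<otimes> b | a b. True}) \<subseteq> ?E"
    by (rule closure_minimal[rotated])
  then show "cblinfun_apply S u = T u"
    unfolding closure_span_tensor by blast
qed

subsection \<open>The norm is the projective norm\<close>

definition projective_norm ::
    "'a::complex_normed_vector \<otimes>\<^sub>p 'b::complex_normed_vector \<Rightarrow> real"
  where "projective_norm u =
    Inf {\<Sum>i<n. norm (a i) * norm (b i) | (n::nat) a b. u = (\<Sum>i<n. a i \<otimes> b i)}"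

lemma tensor_span_representation:
  assumes "u \<in> span {a \<otimes> b | (a::'a::complex_normed_vector) (b::'b::complex_normed_vector). True}"
  obtains n :: nat and a b where "u = (\<Sum>i<n. a i \<otimes> b i)"
proof -
  have "\<exists>(n::nat) a b. u = (\<Sum>i<n. (a i :: 'a) \<otimes> (b i :: 'b))"
    using assms
  proof (induction rule: span_induct_alt)
    case base
    show ?case by (rule exI[where x = 0]) simp
  next
    case (step r t v)
    then obtain n :: nat and a b a' b' where
      v: "v = (\<Sum>i<n. (a i :: 'a) \<otimes> (b i :: 'b))" and t: "t = a' \<otimes> b'"
      by blast
    have "r *\<^sub>R t + v = (\<Sum>i<Suc n. (a(n := complex_of_real r *\<^sub>C a')) i \<otimes> (b(n := b')) i)"
      by (simp add: v t tensor_simps add.commute flip: scaleC_of_real)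
    then show ?case by blast
  qed
  then show thesis using that by blast
qed

lemma projective_norm_le:
  "u = (\<Sum>i<(n::nat). a i \<otimes> b i) \<Longrightarrow> projective_norm u \<le> (\<Sum>i<n. norm (a i) * norm (b i))"
  unfolding projective_norm_def
  by (rule cInf_lower) (auto intro!: bdd_belowI[where m = 0] sum_nonneg)

lemma projective_norm_ge:
  fixes u :: "'a::complex_normed_vector \<otimes>\<^sub>p 'b::complex_normed_vector"
  assumes u: "u \<in> span {a \<otimes> b | a b. True}"
    and m: "\<And>(n::nat) a b. u = (\<Sum>i<n. a i \<otimes> b i) \<Longrightarrow> m \<le> (\<Sum>i<n. norm (a i) * norm (b i))"
  shows "m \<le> projective_norm u"
proof -
  obtain n :: nat and a b where "u = (\<Sum>i<n. a i \<otimes> b i)"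
    using tensor_span_representation[OF u] by blast
  then show ?thesis
    unfolding projective_norm_def by (intro cInf_greatest) (use m in auto)
qed

lemma projective_norm_scaleC_le:
  fixes u :: "'a::complex_normed_vector \<otimes>\<^sub>p 'b::complex_normed_vector"
  assumes u: "u \<in> span {a \<otimes> b | a b. True}"
  shows "projective_norm (c *\<^sub>C u) \<le> cmod c * projective_norm u"
proof (cases "c = 0")
  case True
  have "projective_norm (0 :: 'a \<otimes>\<^sub>p 'b) \<le> 0"
    using projective_norm_le[of "0 :: 'a \<otimes>\<^sub>p 'b" "\<lambda>_. 0" "\<lambda>_. 0" 0] by simp
  moreover have "0 *\<^sub>C u = 0" using scaleC_of_real[of 0 u] by simp
  ultimately show ?thesis using True by simp
next
  case False
  have "projective_norm (c *\<^sub>C u) / cmod c \<le> projective_norm u"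
  proof (rule projective_norm_ge[OF u])
    fix n :: nat and a b assume "u = (\<Sum>i<n. a i \<otimes> b i)"
    then have "c *\<^sub>C u = (\<Sum>i<n. (c *\<^sub>C a i) \<otimes> b i)"
      by (simp add: tensor_simps linear_sum[OF bounded_linear.linear[OF bounded_linear_scaleC]])
    from projective_norm_le[OF this] False
    show "projective_norm (c *\<^sub>C u) / cmod c \<le> (\<Sum>i<n. norm (a i) * norm (b i))"
      by (simp add: norm_scaleC mult.assoc field_simps flip: sum_distrib_left)
  qed
  with False show ?thesis by (simp add: field_simps)
qed

lemma projective_norm_add:
  fixes u v :: "'a::complex_normed_vector \<otimes>\<^sub>p 'b::complex_normed_vector"
  assumes u: "u \<in> span {a \<otimes> b | a b. True}" and v: "v \<in> span {a \<otimes> b | a b. True}"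
  shows "projective_norm (u + v) \<le> projective_norm u + projective_norm v"
proof -
  have *: "projective_norm (u + v)
      \<le> (\<Sum>i<n. norm (a i) * norm (b i)) + (\<Sum>i<m. norm (a' i) * norm (b' i))"
    if "u = (\<Sum>i<n. a i \<otimes> b i)" "v = (\<Sum>i<m. a' i \<otimes> b' i)" for n m :: nat and a b a' b'
  proof -
    let ?a = "\<lambda>i. if i < n then a i else a' (i - n)"
    let ?b = "\<lambda>i. if i < n then b i else b' (i - n)"
    have split: "(\<Sum>i<n + m. h i) = (\<Sum>i<n. h i) + (\<Sum>i<m. h (i + n))"
      for h :: "nat \<Rightarrow> 'd::comm_monoid_add"
      by (induction m) (simp_all add: ac_simps)
    have "u + v = (\<Sum>i<n + m. ?a i \<otimes> ?b i)"
      unfolding split that by simp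
    from projective_norm_le[OF this] show ?thesis
      unfolding split by simp
  qed
  have "projective_norm (u + v) - projective_norm v \<le> projective_norm u"
  proof (rule projective_norm_ge[OF u])
    fix n :: nat and a b assume 1: "u = (\<Sum>i<n. a i \<otimes> b i)"
    have "projective_norm (u + v) - (\<Sum>i<n. norm (a i) * norm (b i)) \<le> projective_norm v"
    proof (rule projective_norm_ge[OF v])
      fix m :: nat and a' b' assume "v = (\<Sum>i<m. a' i \<otimes> b' i)"
      from *[OF 1 this]
      show "projective_norm (u + v) - (\<Sum>i<n. norm (a i) * norm (b i))
          \<le> (\<Sum>i<m. norm (a' i) * norm (b' i))" by simp
    qed
    then show "projective_norm (u + v) - projective_norm v \<le> (\<Sum>i<n. norm (a i) * norm (b i))"
      by simp
  qed
  then show ?thesis by simp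
qed

theorem norm_ptensor:
  fixes u :: "'a::complex_normed_vector \<otimes>\<^sub>p 'b::complex_normed_vector"
  assumes u: "u \<in> span {a \<otimes> b | a b. True}"
  shows "norm u = projective_norm u"
proof (rule antisym)
  show "norm u \<le> projective_norm u"
  proof (rule projective_norm_ge[OF u])
    fix n :: nat and a b assume "u = (\<Sum>i<n. a i \<otimes> b i)"
    then show "norm u \<le> (\<Sum>i<n. norm (a i) * norm (b i))"
      by (auto intro!: order_trans[OF norm_sum] sum_mono norm_tensor_le)
  qed
next
  let ?S = "span {a \<otimes> b | (a :: 'a) (b :: 'b). True}"
  have sub: "subspace ?S" by (rule subspace_span)
  have lin_id: "linear (\<lambda>x :: 'a \<otimes>\<^sub>p 'b. x)" by (rule linearI) simp_all
  obtain P :: "'a \<otimes>\<^sub>p 'b \<Rightarrow> 'a \<otimes>\<^sub>p 'b" where P: "range P \<subseteq> ?S" "linear P" "\<And>v. v \<in> ?S \<Longrightarrow> P v = v"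
    using linear_exists_left_inverse_on[OF lin_id sub] by (auto simp: inj_on_def)
  interpret P: linear P by (rule P(2))
  have PS: "P v \<in> ?S" for v using P(1) by blast
  have scaleR_le: "projective_norm (r *\<^sub>R v) \<le> r * projective_norm v" if "r > 0" "v \<in> ?S" for r v
    using projective_norm_scaleC_le[OF that(2), of "complex_of_real r"] that(1)
    by (simp add: scaleC_of_real)
  have nonneg: "0 \<le> projective_norm v" if "v \<in> ?S" for v
    by (rule projective_norm_ge[OF that]) (simp add: sum_nonneg)
  have zero: "projective_norm (0 :: 'a \<otimes>\<^sub>p 'b) = 0"
    using projective_norm_le[of "0 :: 'a \<otimes>\<^sub>p 'b" "\<lambda>_. 0" "\<lambda>_. 0" 0] nonneg[of 0] by (simp add: span_zero)
  have "sublinear (\<lambda>v. projective_norm (P v))"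
  proof (rule sublinearI)
    show "projective_norm (P (v + w)) \<le> projective_norm (P v) + projective_norm (P w)" for v w
      by (simp add: P.add projective_norm_add[OF PS PS])
    show "projective_norm (P 0) = 0" by (simp add: P.zero zero)
    show "projective_norm (P (r *\<^sub>R v)) \<le> r * projective_norm (P v)" if "r > 0" for r v
      by (simp add: P.scale scaleR_le[OF that PS])
  qed
  then obtain g where g: "linear g" "\<And>v. g v \<le> projective_norm (P v)" "g u = projective_norm (P u)"
    using Hahn_Banach_real[of "\<lambda>v. projective_norm (P v)" u] by blast
  have le: "cmod (complexify g v) \<le> projective_norm v" if v: "v \<in> ?S" for v
  proof (rule cmod_complexify_le[OF g(1)])
    fix c :: complex assume c: "cmod c = 1"
    show "g (c *\<^sub>C v) \<le> projective_norm v"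
      using g(2)[of "c *\<^sub>C v"] P(3)[OF tensor_span_scaleC[OF v], of c]
        projective_norm_scaleC_le[OF v, of c] c by simp
  qed
  note cl = complexify_linear[OF g(1)]
  have le2: "cmod (complexify g (a \<otimes> b)) \<le> norm a * norm b" for a b
  proof -
    have "a \<otimes> b \<in> ?S" by (rule span_base) blast
    then have "cmod (complexify g (a \<otimes> b)) \<le> projective_norm (a \<otimes> b)" by (rule le)
    also have "\<dots> \<le> norm a * norm b"
      using projective_norm_le[of "a \<otimes> b" "\<lambda>_. a" "\<lambda>_. b" 1] by simp
    finally show ?thesis .
  qed
  have inner: "bounded_clinear (\<lambda>b. complexify g (a \<otimes> b))" for a
    by (rule bounded_clinear_intro[where K = "norm a"])
       (use le2 in \<open>simp_all add: tensor_simps cl mult.commute\<close>)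
  have outer: "bounded_clinear (\<lambda>a. CBlinfun (\<lambda>b. complexify g (a \<otimes> b)))"
  proof (rule bounded_clinear_intro[where K = 1])
    show "norm (CBlinfun (\<lambda>b. complexify g (a \<otimes> b))) \<le> norm a * 1" for a
      by (rule CBlinfun_bound[OF inner]) (use le2 in simp_all)
  qed (rule cblinfun_eqI, simp only: CBlinfun_inverse[OF inner] cblinfun_ops_apply,
      simp add: tensor_simps cl)+
  define B where "B = CBlinfun (\<lambda>a. CBlinfun (\<lambda>b. complexify g (a \<otimes> b)))"
  have B: "B a b = complexify g (a \<otimes> b)" for a b
    by (simp add: B_def CBlinfun_inverse inner outer)
  have "norm (B a) \<le> 1 * norm a" for a
    by (rule norm_cblinfun_bound) (use le2 in \<open>simp_all add: B\<close>)
  then have nB: "norm B \<le> 1"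
    by (rule norm_cblinfun_bound[rotated]) simp_all
  have "cblinfun_apply (Rep_ptensor v) B = complexify g v" if "v \<in> ?S" for v
    using that
  proof (induction rule: span_induct_alt)
    case base
    show ?case using cl(2)[of 0 0] by (simp add: Rep_ptensor_ops cblinfun_ops_apply)
  next
    case (step r t v)
    then obtain a b where t: "t = a \<otimes> b" by blast
    have "complexify g (r *\<^sub>R t) = complex_of_real r * complexify g t"
      by (simp add: cl(2) flip: scaleC_of_real)
    with step show ?case
      by (simp add: Rep_ptensor_ops cblinfun_ops_apply cl(1) t Rep_tensor tensor_form_apply B
          scaleR_conv_of_real)
  qed
  from this[OF u] have "cmod (complexify g u) \<le> norm u * norm B"
    using norm_cblinfun_le[of "Rep_ptensor u" B] by (simp add: norm_ptensor_def)
  also have "\<dots> \<le> norm u" using mult_left_mono[OF nB norm_ge_zero[of u]] by simp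
  finally have "cmod (complexify g u) \<le> norm u" .
  moreover have "projective_norm u = Re (complexify g u)"
    by (simp add: complexify_def g(3) P(3)[OF u])
  ultimately show "projective_norm u \<le> norm u"
    using complex_Re_le_cmod[of "complexify g u"] by simp
qed

subsection \<open>Universal property\<close>

definition bounded_cbilinear ::
    "('a::complex_normed_vector \<Rightarrow> 'b::complex_normed_vector \<Rightarrow> 'c::complex_normed_vector) \<Rightarrow> bool"
  where "bounded_cbilinear f \<longleftrightarrow> bounded_bilinear f \<and>
    (\<forall>c a b. f (c *\<^sub>C a) b = c *\<^sub>C f a b \<and> f a (c *\<^sub>C b) = c *\<^sub>C f a b)"

lemma bounded_cbilinear_intro:
  assumes "\<And>a a' b. f (a + a') b = f a b + f a' b" "\<And>a b b'. f a (b + b') = f a b + f a b'"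
    and "\<And>c a b. f (c *\<^sub>C a) b = c *\<^sub>C f a b" "\<And>c a b. f a (c *\<^sub>C b) = c *\<^sub>C f a b"
    and "\<And>a b. norm (f a b) \<le> norm a * norm b * K"
  shows "bounded_cbilinear f"
proof -
  have "bounded_bilinear f"
  proof (rule bounded_bilinear.intro)
    show "f (r *\<^sub>R a) b = r *\<^sub>R f a b" "f a (r *\<^sub>R b) = r *\<^sub>R f a b" for r a b
      using assms(3,4)[where c = "complex_of_real r"] by (simp_all add: scaleC_of_real)
  qed (use assms in auto)
  with assms show ?thesis by (simp add: bounded_cbilinear_def)
qed

definition canonical_embedding :: "'a::complex_normed_vector \<Rightarrow>\<^sub>C\<^sub>L 'a dual dual"
  where "canonical_embedding = CBlinfun (\<lambda>x. CBlinfun (\<lambda>f :: 'a dual. f x))"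

lemma canonical_embedding_apply [simp]:
  "cblinfun_apply (cblinfun_apply canonical_embedding x) f = f x"
  and norm_canonical_embedding: "norm (cblinfun_apply canonical_embedding x) = norm x"
proof -
  have inner: "bounded_clinear (\<lambda>f. cblinfun_apply f x)" for x :: 'a
    by (rule bounded_clinear_intro[where K = "norm x"])
       (simp_all add: cblinfun_ops_apply norm_cblinfun_le)
  have "bounded_clinear (\<lambda>x::'a. CBlinfun (\<lambda>f :: 'a dual. f x) :: 'a dual dual)"
  proof (rule bounded_clinear_intro[where K = 1])
    show "norm (CBlinfun (\<lambda>f :: 'a dual. f x) :: 'a dual dual) \<le> norm x * 1" for x
      by (rule CBlinfun_bound[OF inner]) (use norm_cblinfun_le in \<open>simp_all add: mult.commute\<close>)
  qed (rule cblinfun_eqI, simp only: CBlinfun_inverse[OF inner] cblinfun_ops_apply,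
      simp add: cblinfun_right_simps cblinfun_scaleC_right[where 'b = complex, simplified])+
  then show *: "cblinfun_apply (cblinfun_apply canonical_embedding x) f = f x" for x :: 'a and f
    by (simp add: canonical_embedding_def CBlinfun_inverse inner)
  show "norm (cblinfun_apply canonical_embedding x) = norm x"
  proof (rule antisym)
    show "norm (cblinfun_apply canonical_embedding x) \<le> norm x"
      by (rule norm_cblinfun_bound) (use norm_cblinfun_le in \<open>simp_all add: * mult.commute\<close>)
    obtain f :: "'a dual" where f: "norm f \<le> 1" "f x = complex_of_real (norm x)"
      by (rule dual_norming)
    have "norm x \<le> norm (cblinfun_apply canonical_embedding x) * norm f"
      using norm_cblinfun_le[of "cblinfun_apply canonical_embedding x" f] by (simp add: * f(2))
    also have "\<dots> \<le> norm (cblinfun_apply canonical_embedding x)"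
      using mult_left_mono[OF f(1) norm_ge_zero] by simp
    finally show "norm x \<le> norm (cblinfun_apply canonical_embedding x)" .
  qed
qed

theorem ptensor_universal:
  fixes f :: "'a::complex_normed_vector \<Rightarrow> 'b::complex_normed_vector \<Rightarrow> 'c::complex_banach"
  assumes f: "bounded_cbilinear f"
  shows "\<exists>!T :: 'a \<otimes>\<^sub>p 'b \<Rightarrow>\<^sub>C\<^sub>L 'c. \<forall>a b. T (a \<otimes> b) = f a b"
proof (rule ex_ex1I)
  interpret bounded_bilinear f using f by (simp add: bounded_cbilinear_def)
  obtain K where K: "K \<ge> 0" "\<And>a b. norm (f a b) \<le> norm a * norm b * K"
    using nonneg_bounded by blast
  have fc: "f (c *\<^sub>C a) b = c *\<^sub>C f a b" "f a (c *\<^sub>C b) = c *\<^sub>C f a b" for c a b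
    using f by (simp_all add: bounded_cbilinear_def)
  note cright = cblinfun_right_simps cblinfun_scaleC_right[where 'b = complex, simplified]
  have bound: "cmod (cblinfun_apply \<psi> (f a b)) \<le> norm \<psi> * K * norm a * norm b" for \<psi> :: "'c dual" and a b
    using norm_cblinfun_le'[OF K(2)[of a b], of \<psi>] by (simp add: mult_ac)
  have 1: "bounded_clinear (\<lambda>b. cblinfun_apply \<psi> (f a b))" for \<psi> :: "'c dual" and a
    by (rule bounded_clinear_intro[where K = "norm \<psi> * K * norm a"])
       (use bound in \<open>simp_all add: add_right fc cright mult_ac\<close>)
  have 2: "bounded_clinear (\<lambda>a. CBlinfun (\<lambda>b. cblinfun_apply \<psi> (f a b)))" for \<psi> :: "'c dual"
  proof (rule bounded_clinear_intro[where K = "norm \<psi> * K"])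
    show "norm (CBlinfun (\<lambda>b. cblinfun_apply \<psi> (f a b))) \<le> norm a * (norm \<psi> * K)" for a
      by (rule CBlinfun_bound[OF 1]) (use K(1) bound in \<open>simp_all add: mult_ac\<close>)
  qed (rule cblinfun_eqI, simp only: CBlinfun_inverse[OF 1] cblinfun_ops_apply,
      simp add: add_left fc cright)+
  define N :: "'c dual \<Rightarrow> 'a \<Rightarrow>\<^sub>C\<^sub>L 'b dual"
    where "N \<psi> = CBlinfun (\<lambda>a. CBlinfun (\<lambda>b. \<psi> (f a b)))" for \<psi>
  have N: "N \<psi> a b = \<psi> (f a b)" for \<psi> a b
    by (simp add: N_def CBlinfun_inverse 1 2)
  have "norm (N \<psi> a) \<le> norm \<psi> * K * norm a" for \<psi> a
    by (rule norm_cblinfun_bound) (use K(1) bound in \<open>simp_all add: N\<close>)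
  then have "norm (N \<psi>) \<le> norm \<psi> * K" for \<psi>
    by (rule norm_cblinfun_bound[rotated]) (use K(1) in simp_all)
  then have "bounded_clinear N"
    by (intro bounded_clinear_intro[where K = K])
       (auto intro!: cblinfun_eqI simp: N cblinfun_ops_apply)
  then have M: "cblinfun_apply (CBlinfun N) = N" by (rule CBlinfun_inverse)
  define T where "T u = Rep_ptensor u o\<^sub>C\<^sub>L CBlinfun N" for u
  let ?\<iota> = "canonical_embedding :: 'c \<Rightarrow>\<^sub>C\<^sub>L 'c dual dual"
  have T_tensor: "T (a \<otimes> b) = ?\<iota> (f a b)" for a b
    by (rule cblinfun_eqI) (simp add: T_def M N Rep_tensor tensor_form_apply)
  have T: "bounded_clinear T"
  proof (rule bounded_clinear_intro[where K = "norm (CBlinfun N)"])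
    show "norm (T u) \<le> norm u * norm (CBlinfun N)" for u
      unfolding T_def norm_ptensor_def by (rule norm_cblinfun_compose)
  qed (rule cblinfun_eqI, simp add: T_def Rep_ptensor_ops cblinfun_ops_apply)+
  have "complete (range ?\<iota>)"
    by (rule complete_isometric_image[of 1])
       (simp_all add: bounded_linear_cblinfun norm_canonical_embedding complete_UNIV)
  then have "closed (range ?\<iota>)" by (simp add: complete_eq_closed)
  moreover have "subspace (range ?\<iota>)"
    by (intro linear_subspace_image bounded_linear.linear[OF bounded_linear_cblinfun] subspace_UNIV)
  ultimately have "closed (T -` range ?\<iota>)" "subspace (T -` range ?\<iota>)"
    using T by (auto simp: bounded_clinear_def intro!: linear_subspace_vimage bounded_linear.linear
        continuous_closed_vimage bounded_linear.isCont[OF _ continuous_ident])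
  moreover have "{a \<otimes> b | a b. True} \<subseteq> T -` range ?\<iota>"
    by (auto simp: T_tensor)
  ultimately have "closure (span {a \<otimes> b | a b. True}) \<subseteq> T -` range ?\<iota>"
    by (intro closure_minimal span_minimal)
  then have "\<exists>y. T u = ?\<iota> y" for u
    unfolding closure_span_tensor by blast
  then obtain L where L: "\<And>u. T u = ?\<iota> (L u)" by metis
  have inj: "x = y" if "?\<iota> x = ?\<iota> y" for x y
    using norm_canonical_embedding[of "x - y"] that by (simp add: cblinfun_right_simps)
  have "bounded_clinear L"
  proof (rule bounded_clinear_intro[where K = "norm (CBlinfun T)"])
    have "T (u + v) = T u + T v" "T (c *\<^sub>C u) = c *\<^sub>C T u" for u v c
      using T by (simp_all add: bounded_clinear_def linear_simps)
    then show "L (u + v) = L u + L v" "L (c *\<^sub>C u) = c *\<^sub>C L u" for u v c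
      by (auto intro!: inj simp: cblinfun_right_simps L[symmetric])
    show "norm (L u) \<le> norm u * norm (CBlinfun T)" for u
      using norm_cblinfun_le[of "CBlinfun T" u]
      by (simp add: CBlinfun_inverse[OF T] L norm_canonical_embedding mult.commute)
  qed
  moreover have "L (a \<otimes> b) = f a b" for a b
    by (rule inj) (simp add: L[symmetric] T_tensor)
  ultimately have "\<forall>a b. CBlinfun L (a \<otimes> b) = f a b" by (simp add: CBlinfun_inverse)
  then show "\<exists>T :: 'a \<otimes>\<^sub>p 'b \<Rightarrow>\<^sub>C\<^sub>L 'c. \<forall>a b. T (a \<otimes> b) = f a b" by blast
next
  fix S T :: "'a \<otimes>\<^sub>p 'b \<Rightarrow>\<^sub>C\<^sub>L 'c"
  assume "\<forall>a b. S (a \<otimes> b) = f a b" "\<forall>a b. T (a \<otimes> b) = f a b"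
  then show "S = T" by (intro ptensor_operator_eqI) simp
qed

text \<open>Only meaningful if \<open>f\<close> is \<open>bounded_cbilinear\<close>.\<close>

definition ptensor_lift ::
    "('a::complex_normed_vector \<Rightarrow> 'b::complex_normed_vector \<Rightarrow> 'c::complex_banach) \<Rightarrow> 'a \<otimes>\<^sub>p 'b \<Rightarrow>\<^sub>C\<^sub>L 'c"
  where "ptensor_lift f = (THE T :: 'a \<otimes>\<^sub>p 'b \<Rightarrow>\<^sub>C\<^sub>L 'c. \<forall>a b. T (a \<otimes> b) = f a b)"

lemma ptensor_lift_tensor:
  "bounded_cbilinear f \<Longrightarrow> cblinfun_apply (ptensor_lift f) (a \<otimes> b) = f a b"
  unfolding ptensor_lift_def using theI'[OF ptensor_universal] by blast

section \<open>Characters, left \<phi>-biprojectivity and left \<phi>-biflatness\<close>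

text \<open>Non-zero multiplicative linear functionals; these are automatically bounded
  (\<open>multiplicative_functional_bounded\<close>).\<close>

definition characters :: "'a::complex_banach_algebra dual set"
  where "characters = {\<phi>. \<phi> \<noteq> (0 :: 'a dual) \<and> (\<forall>a b. \<phi> (a * b) = \<phi> a * \<phi> b)}"

lemma multiplicative_functional_bounded:
  fixes f :: "'a::complex_banach_algebra \<Rightarrow> complex"
  assumes add: "\<And>x y. f (x + y) = f x + f y" and scale: "\<And>c x. f (c *\<^sub>C x) = c * f x"
    and mult: "\<And>x y. f (x * y) = f x * f y"
  shows "bounded_clinear f"
proof -
  have "cmod (f x) \<le> norm x" for x
  proof (rule ccontr)
    assume "\<not> cmod (f x) \<le> norm x"
    then have lt: "norm x < cmod (f x)" by simp
    then have nz: "f x \<noteq> 0" using norm_ge_zero[of x] by auto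
    define y where "y = (1 / f x) *\<^sub>C x"
    have y1: "norm y < 1" using lt nz by (simp add: y_def norm_scaleC norm_divide)
    have fy: "f y = 1" using nz by (simp add: y_def scale)
    define p where "p = rec_nat y (\<lambda>_ q. y * q)"
    have p: "p 0 = y" "p (Suc n) = y * p n" for n by (simp_all add: p_def)
    have le: "norm (p n) \<le> norm y ^ Suc n" for n
    proof (induction n)
      case (Suc n)
      have "norm (p (Suc n)) \<le> norm y * norm (p n)" by (simp add: p norm_mult_ineq)
      also have "\<dots> \<le> norm y * norm y ^ Suc n" by (intro mult_left_mono Suc.IH norm_ge_zero)
      finally show ?case by simp
    qed (simp add: p)
    have sy: "summable (\<lambda>n. norm y ^ Suc n)"
      using y1 by (simp add: summable_mult summable_geometric)
    have sum: "summable p" by (rule summable_comparison_test'[OF sy, of 0]) (rule le)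
    have "suminf p = y + (\<Sum>n. p (Suc n))"
      using suminf_split_head[OF sum] by (simp add: p algebra_simps)
    also have "(\<Sum>n. p (Suc n)) = y * suminf p"
      by (simp add: p bounded_linear.suminf[OF bounded_linear_mult_right sum])
    finally have "f (suminf p) = f (y + y * suminf p)" by (rule arg_cong)
    then show False by (simp add: add mult fy)
  qed
  then show ?thesis
    by (intro bounded_clinear_intro[where K = 1]) (simp_all add: add scale)
qed

text \<open>The extension of \<open>\<phi>\<close> to the bidual, \<open>F \<mapsto> F(\<phi>)\<close>.\<close>

definition bidual_extension :: "'a::complex_banach_algebra dual \<Rightarrow> 'a bidual dual"
  where "bidual_extension \<phi> = CBlinfun (\<lambda>F. of_bidual F \<phi>)"

lemma bidual_extension_apply: "cblinfun_apply (bidual_extension \<phi>) F = of_bidual F \<phi>"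
proof -
  have "bounded_clinear (\<lambda>F. cblinfun_apply (of_bidual F) \<phi>)"
    by (rule bounded_clinear_intro[where K = "norm \<phi>"])
       (simp_all add: of_bidual_ops cblinfun_ops_apply norm_bidual_def norm_cblinfun_le)
  then show ?thesis by (simp add: bidual_extension_def CBlinfun_inverse)
qed

lemma bidual_extension_character:
  fixes \<phi> :: "'a::complex_banach_algebra dual"
  assumes "\<phi> \<in> characters"
  shows "bidual_extension \<phi> \<in> characters"
proof -
  have mult: "\<phi> (a * b) = \<phi> a * \<phi> b" for a b using assms by (simp add: characters_def)
  have act: "arens_act G \<phi> = G \<phi> *\<^sub>C \<phi>" for G :: "'a dual dual"
  proof (rule cblinfun_eqI)
    fix a
    have "dual_right_action lmult a \<phi> = \<phi> a *\<^sub>C \<phi>"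
      by (rule cblinfun_eqI) (simp add: dual_action_apply mult cblinfun_ops_apply)
    then show "arens_act G \<phi> a = cblinfun_apply (G \<phi> *\<^sub>C \<phi>) a"
      by (simp add: arens_act_apply cblinfun_ops_apply cblinfun_scaleC_right[of G, simplified])
  qed
  have "bidual_extension \<phi> (F * G) = bidual_extension \<phi> F * bidual_extension \<phi> G" for F G
    by (simp add: bidual_extension_apply of_bidual_times arens_apply act
        cblinfun_scaleC_right[of "of_bidual F", simplified])
  moreover have "bidual_extension \<phi> \<noteq> 0"
  proof
    assume "bidual_extension \<phi> = 0"
    then have "of_bidual (to_bidual (canonical_embedding x)) \<phi> = 0" for x
      by (simp only: bidual_extension_apply[symmetric] cblinfun_ops_apply)
    then have "\<phi> = 0" by (intro cblinfun_eqI) (simp add: cblinfun_ops_apply)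
    then show False using assms by (simp add: characters_def)
  qed
  ultimately show ?thesis by (simp add: characters_def)
qed

text \<open>\<open>\<pi>(a \<otimes> b) = ab\<close> and \<open>a \<cdot> (b \<otimes> c) = ab \<otimes> c\<close>.  The right module action on the tensor
  product plays no role below.\<close>

definition ptensor_mult :: "'a::complex_banach_algebra \<otimes>\<^sub>p 'a \<Rightarrow>\<^sub>C\<^sub>L 'a"
  where "ptensor_mult = ptensor_lift (\<lambda>a b. a * b)"

definition ptensor_left_action ::
    "'a::complex_banach_algebra \<Rightarrow> ('a \<otimes>\<^sub>p 'a \<Rightarrow>\<^sub>C\<^sub>L 'a \<otimes>\<^sub>p 'a)"
  where "ptensor_left_action a = ptensor_lift (\<lambda>b c. (a * b) \<otimes> c)"

lemma ptensor_mult_tensor: "cblinfun_apply ptensor_mult (a \<otimes> b) = a * b"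
proof -
  have "bounded_cbilinear (\<lambda>a b :: 'a. a * b)"
    by (rule bounded_cbilinear_intro[where K = 1])
       (simp_all add: distrib_left distrib_right scaleC_mult_left scaleC_mult_right norm_mult_ineq)
  then show ?thesis unfolding ptensor_mult_def by (rule ptensor_lift_tensor)
qed

lemma ptensor_left_action_tensor:
  "cblinfun_apply (ptensor_left_action a) (b \<otimes> c) = (a * b) \<otimes> c"
proof -
  have "bounded_cbilinear (\<lambda>b c :: 'a. (a * b) \<otimes> c)"
  proof (rule bounded_cbilinear_intro[where K = "norm a"])
    fix b c :: 'a
    have "norm ((a * b) \<otimes> c) \<le> norm (a * b) * norm c" by (rule norm_tensor_le)
    also have "\<dots> \<le> (norm a * norm b) * norm c"
      by (intro mult_right_mono norm_mult_ineq norm_ge_zero)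
    finally show "norm ((a * b) \<otimes> c) \<le> norm b * norm c * norm a" by (simp add: mult_ac)
  qed (simp_all add: distrib_left tensor_simps scaleC_mult_right)
  then show ?thesis unfolding ptensor_left_action_def by (rule ptensor_lift_tensor)
qed

definition left_biprojective :: "'a::complex_banach_algebra dual \<Rightarrow> bool"
  where "left_biprojective \<phi> \<longleftrightarrow> (\<exists>\<rho> :: 'a \<Rightarrow>\<^sub>C\<^sub>L 'a \<otimes>\<^sub>p 'a.
    (\<forall>a b. \<rho> (a * b) = ptensor_left_action a (\<rho> b)) \<and>
    (\<forall>a b. \<rho> (a * b) = \<phi> b *\<^sub>C \<rho> a) \<and>
    (\<forall>a. \<phi> (ptensor_mult (\<rho> a)) = \<phi> a))"

definition ptensor_bidual_left_action ::
    "'a::complex_banach_algebra \<Rightarrow> (('a \<otimes>\<^sub>p 'a) dual dual \<Rightarrow>\<^sub>C\<^sub>L ('a \<otimes>\<^sub>p 'a) dual dual)"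
  where "ptensor_bidual_left_action = dual_left_action (dual_right_action ptensor_left_action)"

definition ptensor_mult_bidual :: "('a::complex_banach_algebra \<otimes>\<^sub>p 'a) dual dual \<Rightarrow>\<^sub>C\<^sub>L 'a dual dual"
  where "ptensor_mult_bidual = cadjoint (cadjoint ptensor_mult)"

definition left_biflat :: "'a::complex_banach_algebra dual \<Rightarrow> bool"
  where "left_biflat \<phi> \<longleftrightarrow> (\<exists>\<rho> :: 'a \<Rightarrow>\<^sub>C\<^sub>L ('a \<otimes>\<^sub>p 'a) dual dual.
    (\<forall>a b. \<rho> (a * b) = \<phi> b *\<^sub>C \<rho> a) \<and>
    (\<forall>a b. \<rho> (a * b) = ptensor_bidual_left_action a (\<rho> b)) \<and>
    (\<forall>a. bidual_extension \<phi> (to_bidual (ptensor_mult_bidual (\<rho> a))) = \<phi> a))"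

end

theory Submission
  imports Defs
begin

text \<open>
  The projective tensor square of the bidual \<open>A\<^sup>*\<^sup>*\<close> maps into the bidual of the projective
  tensor square of \<open>A\<close>: a functional \<open>f\<close> on
  \<open>A \<otimes>\<^sub>p A\<close> is a bounded bilinear form on \<open>A \<times> A\<close>, and its iterated extension to the biduals,
  \<open>(F, G) \<mapsto> F (a \<mapsto> G (b \<mapsto> f (a \<otimes> b)))\<close>, is the value at \<open>f\<close> of an element of
  \<open>(A \<otimes>\<^sub>p A)\<^sup>*\<^sup>*\<close> depending bilinearly and boundedly on \<open>F\<close> and \<open>G\<close>.  By the universal property
  this gives a bounded operator \<open>\<Psi> : A\<^sup>*\<^sup>* \<otimes>\<^sub>p A\<^sup>*\<^sup>* \<rightarrow> (A \<otimes>\<^sub>p A)\<^sup>*\<^sup>*\<close>.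

  For \<open>a\<close> in \<open>A\<close> the first Arens product satisfies \<open>(a F) f = F (b \<mapsto> f (a b))\<close>, so \<open>\<Psi>\<close>
  intertwines the left actions of \<open>A\<close> (\<open>bidual_tensor_map_left_action\<close>).  The functional
  \<open>\<phi> \<circ> \<pi>\<close> is the bilinear form \<open>(a, b) \<mapsto> \<phi> a * \<phi> b\<close>, at which \<open>\<Psi> (F \<otimes> G)\<close> takes the value
  \<open>F \<phi> * G \<phi>\<close>; this is also the value of the extended character at the product \<open>F * G\<close>
  (\<open>bidual_tensor_map_character\<close>).
  Hence, if \<open>\<rho>\<close> witnesses biprojectivity of \<open>A\<^sup>*\<^sup>*\<close>, the operator
  \<open>a \<mapsto> \<Psi> (\<rho> a)\<close>, with \<open>a\<close> embedded canonically in \<open>A\<^sup>*\<^sup>*\<close>, witnesses biflatness of \<open>A\<close>.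
\<close>

section \<open>Iterated extension of bilinear forms to the biduals\<close>

text \<open>The operator \<open>y \<mapsto> x \<otimes> y\<close>.\<close>

definition tensor_right ::
    "'x::complex_normed_vector \<Rightarrow> ('y::complex_normed_vector \<Rightarrow>\<^sub>C\<^sub>L 'x \<otimes>\<^sub>p 'y)"
  where "tensor_right x = CBlinfun (\<lambda>y. x \<otimes> y)"

lemma tensor_right_apply [simp]: "cblinfun_apply (tensor_right x) y = x \<otimes> y"
proof -
  have "bounded_clinear (\<lambda>y :: 'b. x \<otimes> y)"
    by (rule bounded_clinear_intro[where K = "norm x"])
       (simp_all add: tensor_simps norm_tensor_le mult.commute)
  then show ?thesis by (simp add: tensor_right_def CBlinfun_inverse)
qed

text \<open>The bilinear form \<open>x \<mapsto> (y \<mapsto> f (x \<otimes> y))\<close> belonging to a functional \<open>f\<close> on the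
  projective tensor product.\<close>

definition ptensor_curry ::
    "('x::complex_normed_vector \<otimes>\<^sub>p 'y::complex_normed_vector) dual \<Rightarrow> ('x \<Rightarrow>\<^sub>C\<^sub>L 'y dual)"
  where "ptensor_curry f = CBlinfun (\<lambda>x. f o\<^sub>C\<^sub>L tensor_right x)"

lemma norm_functional_tensor_right:
  fixes f :: "('x::complex_normed_vector \<otimes>\<^sub>p 'y::complex_normed_vector) dual"
  shows "norm (f o\<^sub>C\<^sub>L tensor_right x) \<le> norm f * norm x"
proof (rule norm_cblinfun_bound)
  show "norm (cblinfun_apply (f o\<^sub>C\<^sub>L tensor_right x) y) \<le> norm f * norm x * norm y" for y
    using norm_cblinfun_le'[OF norm_tensor_le[of x y], of f] by (simp add: mult.assoc)
qed simp

lemma ptensor_curry_apply: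
  "cblinfun_apply (cblinfun_apply (ptensor_curry f) x) y = f (x \<otimes> y)"
proof -
  have "bounded_clinear (\<lambda>x. f o\<^sub>C\<^sub>L tensor_right x)"
  proof (rule bounded_clinear_intro[where K = "norm f"])
    show "norm (f o\<^sub>C\<^sub>L tensor_right x) \<le> norm x * norm f" for x
      using norm_functional_tensor_right[of f x] by (simp add: mult.commute)
  qed (rule cblinfun_eqI, simp add: tensor_simps cblinfun_ops_apply cblinfun_right_simps
      cblinfun_scaleC_right[where 'b = complex, simplified])+
  then show ?thesis by (simp add: ptensor_curry_def CBlinfun_inverse)
qed

lemma norm_ptensor_curry: "norm (ptensor_curry f) \<le> norm f"
proof (rule norm_cblinfun_bound)
  fix x
  show "norm (cblinfun_apply (ptensor_curry f) x) \<le> norm f * norm x"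
  proof (rule norm_cblinfun_bound)
    show "norm (cblinfun_apply (cblinfun_apply (ptensor_curry f) x) y)
        \<le> norm f * norm x * norm y" for y
      using norm_cblinfun_le'[OF norm_tensor_le[of x y], of f]
      by (simp add: ptensor_curry_apply mult.assoc)
  qed simp
qed simp

lemma ptensor_curry_simps:
  "ptensor_curry (f + g) = ptensor_curry f + ptensor_curry g"
  "ptensor_curry (c *\<^sub>C f) = c *\<^sub>C ptensor_curry f"
  by (rule cblinfun_eqI, rule cblinfun_eqI,
      simp add: ptensor_curry_apply cblinfun_ops_apply)+

text \<open>The functional \<open>f \<mapsto> F (x \<mapsto> G (y \<mapsto> f (x \<otimes> y)))\<close>.\<close>

definition bidual_tensor ::
    "'x::complex_normed_vector dual dual \<Rightarrow> 'y::complex_normed_vector dual dual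
      \<Rightarrow> ('x \<otimes>\<^sub>p 'y) dual dual"
  where "bidual_tensor F G = CBlinfun (\<lambda>f. F (G o\<^sub>C\<^sub>L ptensor_curry f))"

lemma norm_iterated_extension:
  "norm (cblinfun_apply F (G o\<^sub>C\<^sub>L ptensor_curry f)) \<le> norm F * norm G * norm f"
proof -
  have "norm (G o\<^sub>C\<^sub>L ptensor_curry f) \<le> norm G * norm f"
    using norm_cblinfun_compose[of G "ptensor_curry f"]
      mult_left_mono[OF norm_ptensor_curry[of f] norm_ge_zero[of G]] by linarith
  from norm_cblinfun_le'[OF this, of F] show ?thesis by (simp add: mult.assoc)
qed

lemma bounded_clinear_iterated_extension:
  fixes F :: "'x::complex_normed_vector dual dual"
    and G :: "'y::complex_normed_vector dual dual"
  shows "bounded_clinear (\<lambda>f. cblinfun_apply F (G o\<^sub>C\<^sub>L ptensor_curry f))"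
proof (rule bounded_clinear_intro[where K = "norm F * norm G"])
  have comp: "G o\<^sub>C\<^sub>L ptensor_curry (f + g) = (G o\<^sub>C\<^sub>L ptensor_curry f) + (G o\<^sub>C\<^sub>L ptensor_curry g)"
    "G o\<^sub>C\<^sub>L ptensor_curry (c *\<^sub>C f) = c *\<^sub>C (G o\<^sub>C\<^sub>L ptensor_curry f)"
    for f g :: "('x \<otimes>\<^sub>p 'y) dual" and c
    by (rule cblinfun_eqI, simp add: ptensor_curry_simps cblinfun_ops_apply cblinfun_right_simps
        cblinfun_scaleC_right[of G, simplified])+
  show "cblinfun_apply F (G o\<^sub>C\<^sub>L ptensor_curry (f + g))
      = F (G o\<^sub>C\<^sub>L ptensor_curry f) + F (G o\<^sub>C\<^sub>L ptensor_curry g)" for f g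
    by (simp add: comp cblinfun_right_simps)
  show "cblinfun_apply F (G o\<^sub>C\<^sub>L ptensor_curry (c *\<^sub>C f)) = c *\<^sub>C F (G o\<^sub>C\<^sub>L ptensor_curry f)" for c f
    by (simp add: comp cblinfun_scaleC_right[of F, simplified])
  show "norm (cblinfun_apply F (G o\<^sub>C\<^sub>L ptensor_curry f)) \<le> norm f * (norm F * norm G)" for f
    using norm_iterated_extension[of F G f] by (simp add: mult_ac)
qed

lemma bidual_tensor_apply:
  "cblinfun_apply (bidual_tensor F G) f = F (G o\<^sub>C\<^sub>L ptensor_curry f)"
  by (simp add: bidual_tensor_def CBlinfun_inverse bounded_clinear_iterated_extension)

lemma norm_bidual_tensor: "norm (bidual_tensor F G) \<le> norm F * norm G"
  by (rule norm_cblinfun_bound) (simp_all add: bidual_tensor_apply norm_iterated_extension)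

lemma bounded_cbilinear_bidual_tensor:
  "bounded_cbilinear (\<lambda>(F :: 'a::complex_banach_algebra bidual) (G :: 'a bidual).
    bidual_tensor (of_bidual F) (of_bidual G))"
proof (rule bounded_cbilinear_intro[where K = 1])
  fix F F' G G' :: "'a bidual" and c
  have comp: "(H + H') o\<^sub>C\<^sub>L T = (H o\<^sub>C\<^sub>L T) + (H' o\<^sub>C\<^sub>L T)"
    "(c *\<^sub>C H) o\<^sub>C\<^sub>L T = c *\<^sub>C (H o\<^sub>C\<^sub>L T)"
    for H H' :: "'a dual dual" and T :: "'a \<Rightarrow>\<^sub>C\<^sub>L 'a dual"
    by (rule cblinfun_eqI, simp add: cblinfun_ops_apply)+
  note rules = bidual_tensor_apply of_bidual_ops cblinfun_ops_apply comp cblinfun_right_simps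
    cblinfun_scaleC_right[where 'b = complex, simplified]
  show "bidual_tensor (of_bidual (F + F')) (of_bidual G)
      = bidual_tensor (of_bidual F) (of_bidual G) + bidual_tensor (of_bidual F') (of_bidual G)"
    "bidual_tensor (of_bidual F) (of_bidual (G + G'))
      = bidual_tensor (of_bidual F) (of_bidual G) + bidual_tensor (of_bidual F) (of_bidual G')"
    "bidual_tensor (of_bidual (c *\<^sub>C F)) (of_bidual G)
      = c *\<^sub>C bidual_tensor (of_bidual F) (of_bidual G)"
    "bidual_tensor (of_bidual F) (of_bidual (c *\<^sub>C G))
      = c *\<^sub>C bidual_tensor (of_bidual F) (of_bidual G)"
    by (rule cblinfun_eqI, simp add: rules)+
  show "norm (bidual_tensor (of_bidual F) (of_bidual G)) \<le> norm F * norm G * 1"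
    by (simp add: norm_bidual_def norm_bidual_tensor)
qed

section \<open>The comparison map between the tensor product of biduals and the bidual\<close>

text \<open>The operator \<open>\<Psi>\<close> with \<open>\<Psi> (F \<otimes> G) f = F (a \<mapsto> G (b \<mapsto> f (a \<otimes> b)))\<close>.\<close>

definition bidual_tensor_map ::
    "'a::complex_banach_algebra bidual \<otimes>\<^sub>p 'a bidual \<Rightarrow>\<^sub>C\<^sub>L ('a \<otimes>\<^sub>p 'a) dual dual"
  where "bidual_tensor_map =
    ptensor_lift (\<lambda>F G. bidual_tensor (of_bidual F) (of_bidual G))"

lemma bidual_tensor_map_tensor:
  "cblinfun_apply bidual_tensor_map (F \<otimes> G) = bidual_tensor (of_bidual F) (of_bidual G)"
  unfolding bidual_tensor_map_def by (rule ptensor_lift_tensor[OF bounded_cbilinear_bidual_tensor])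

text \<open>The canonical embedding into the bidual as a Banach algebra.\<close>

definition bidual_embedding :: "'a::complex_banach_algebra \<Rightarrow>\<^sub>C\<^sub>L 'a bidual"
  where "bidual_embedding = CBlinfun (\<lambda>a. to_bidual (canonical_embedding a))"

lemma of_bidual_embedding [simp]:
  "of_bidual (cblinfun_apply bidual_embedding a) = canonical_embedding a"
proof -
  have "bounded_clinear (\<lambda>a::'a. to_bidual (canonical_embedding a))"
    by (rule bounded_clinear_intro[where K = 1])
       (simp_all add: of_bidual_inject[symmetric] of_bidual_ops cblinfun_right_simps
         norm_bidual_def norm_canonical_embedding)
  then show ?thesis by (simp add: bidual_embedding_def CBlinfun_inverse)
qed

lemma bidual_embedding_mult: "bidual_embedding (a * b) = bidual_embedding a * bidual_embedding b"
  unfolding of_bidual_inject[symmetric]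
  by (rule cblinfun_eqI)
     (simp add: of_bidual_times arens_apply arens_act_apply dual_action_apply)

lemma bidual_extension_embedding:
  "cblinfun_apply (bidual_extension \<phi>) (bidual_embedding a) = \<phi> a"
  by (simp add: bidual_extension_apply)

lemma bidual_tensor_map_left_action:
  fixes a :: "'a::complex_banach_algebra"
  shows "bidual_tensor_map (ptensor_left_action (bidual_embedding a) u)
    = ptensor_bidual_left_action a (bidual_tensor_map u)"
proof -
  have "bidual_tensor_map o\<^sub>C\<^sub>L ptensor_left_action (bidual_embedding a)
      = ptensor_bidual_left_action a o\<^sub>C\<^sub>L bidual_tensor_map"
  proof (rule ptensor_operator_eqI, rule cblinfun_eqI)
    fix F G :: "'a bidual" and f :: "('a \<otimes>\<^sub>p 'a) dual"
    let ?g = "of_bidual G o\<^sub>C\<^sub>L ptensor_curry f"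
    \<comment> \<open>Acting by \<open>a\<close> on \<open>f\<close> and then contracting the second variable with \<open>G\<close> is the same
        as contracting first and then acting.\<close>
    have curry: "ptensor_curry (dual_right_action ptensor_left_action a f) b
        = ptensor_curry f (a * b)" for b
      by (rule cblinfun_eqI)
         (simp add: ptensor_curry_apply dual_action_apply ptensor_left_action_tensor)
    have "of_bidual G o\<^sub>C\<^sub>L ptensor_curry (dual_right_action ptensor_left_action a f)
        = dual_right_action lmult a ?g"
      by (rule cblinfun_eqI) (simp add: curry dual_action_apply)
    then show "cblinfun_apply (cblinfun_apply
          (bidual_tensor_map o\<^sub>C\<^sub>L ptensor_left_action (bidual_embedding a)) (F \<otimes> G)) f
        = (ptensor_bidual_left_action a o\<^sub>C\<^sub>L bidual_tensor_map) (F \<otimes> G) f"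
      by (simp add: ptensor_left_action_tensor bidual_tensor_map_tensor bidual_tensor_apply
          of_bidual_times arens_apply arens_act_apply ptensor_bidual_left_action_def
          dual_action_apply)
  qed
  then show ?thesis by (metis cblinfun_compose_apply)
qed

lemma bidual_tensor_map_character:
  fixes \<phi> :: "'a::complex_banach_algebra dual"
  assumes \<phi>: "\<phi> \<in> characters"
  shows "bidual_extension \<phi> (to_bidual (ptensor_mult_bidual (bidual_tensor_map u)))
    = bidual_extension \<phi> (ptensor_mult u)"
proof -
  \<comment> \<open>Evaluation at \<open>\<phi> \<circ> \<pi>\<close> after \<open>\<Psi>\<close>, as an operator, so that it suffices to compare on
      elementary tensors.\<close>
  let ?ev = "canonical_embedding (\<phi> o\<^sub>C\<^sub>L ptensor_mult) :: ('a \<otimes>\<^sub>p 'a) dual dual dual"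
  have "?ev o\<^sub>C\<^sub>L bidual_tensor_map = bidual_extension \<phi> o\<^sub>C\<^sub>L ptensor_mult"
  proof (rule ptensor_operator_eqI)
    fix F G :: "'a bidual"
    have "ptensor_curry (\<phi> o\<^sub>C\<^sub>L ptensor_mult) a = \<phi> a *\<^sub>C \<phi>" for a
      by (rule cblinfun_eqI)
         (use \<phi> in \<open>simp add: ptensor_curry_apply ptensor_mult_tensor cblinfun_ops_apply
            characters_def\<close>)
    then have "of_bidual G o\<^sub>C\<^sub>L ptensor_curry (\<phi> o\<^sub>C\<^sub>L ptensor_mult) = of_bidual G \<phi> *\<^sub>C \<phi>"
      by (intro cblinfun_eqI)
         (simp add: cblinfun_ops_apply cblinfun_scaleC_right[of "of_bidual G", simplified])
    then have "(?ev o\<^sub>C\<^sub>L bidual_tensor_map) (F \<otimes> G) = of_bidual F \<phi> * of_bidual G \<phi>"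
      by (simp add: bidual_tensor_map_tensor bidual_tensor_apply
          cblinfun_scaleC_right[of "of_bidual F", simplified])
    moreover have "bidual_extension \<phi> (F * G) = of_bidual F \<phi> * of_bidual G \<phi>"
      using bidual_extension_character[OF \<phi>]
      by (simp add: characters_def bidual_extension_apply)
    ultimately show "(?ev o\<^sub>C\<^sub>L bidual_tensor_map) (F \<otimes> G)
        = (bidual_extension \<phi> o\<^sub>C\<^sub>L ptensor_mult) (F \<otimes> G)"
      by (simp add: ptensor_mult_tensor)
  qed
  then have "cblinfun_apply (?ev o\<^sub>C\<^sub>L bidual_tensor_map) u
      = (bidual_extension \<phi> o\<^sub>C\<^sub>L ptensor_mult) u"
    by simp
  then show ?thesis
    by (simp add: bidual_extension_apply ptensor_mult_bidual_def)
qed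

section \<open>Biprojectivity of the bidual implies biflatness\<close>

theorem proposition3p3:
  fixes \<phi> :: "'a::complex_banach_algebra dual"
  assumes "\<phi> \<in> characters"
    and "left_biprojective (bidual_extension \<phi>)"
  shows "left_biflat \<phi>"
proof -
  obtain \<rho> :: "'a bidual \<Rightarrow>\<^sub>C\<^sub>L 'a bidual \<otimes>\<^sub>p 'a bidual" where
    left: "\<And>F G. \<rho> (F * G) = ptensor_left_action F (\<rho> G)" and
    right: "\<And>F G. \<rho> (F * G) = bidual_extension \<phi> G *\<^sub>C \<rho> F" and
    char: "\<And>F. bidual_extension \<phi> (ptensor_mult (\<rho> F)) = bidual_extension \<phi> F"
    using assms(2) unfolding left_biprojective_def by blast
  define \<sigma> where "\<sigma> = bidual_tensor_map o\<^sub>C\<^sub>L \<rho> o\<^sub>C\<^sub>L bidual_embedding"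
  have \<sigma>: "\<sigma> a = bidual_tensor_map (\<rho> (bidual_embedding a))" for a
    by (simp add: \<sigma>_def)
  have "\<sigma> (a * b) = \<phi> b *\<^sub>C \<sigma> a" for a b
    by (simp only: \<sigma> bidual_embedding_mult right bidual_extension_embedding cblinfun_scaleC_right)
  moreover have "\<sigma> (a * b) = ptensor_bidual_left_action a (\<sigma> b)" for a b
    by (simp only: \<sigma> bidual_embedding_mult left bidual_tensor_map_left_action)
  moreover have "bidual_extension \<phi> (to_bidual (ptensor_mult_bidual (\<sigma> a))) = \<phi> a" for a
    by (simp only: \<sigma> bidual_tensor_map_character[OF assms(1)] char bidual_extension_embedding)
  ultimately show ?thesis unfolding left_biflat_def by blast
qed

end
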